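(* Let $1\le m<d$, $W\sim\mathcal N(0,I_m)$, $R\sim\mathcal N(0,\sigma^2I_d)$ independent of $W$ with $\sigma>0$, and $L^*=U^*(\Lambda^* )^{1/2}$ where $U^*\in\mathbb R^{d\times m}$ has orthonormal columns and $\Lambda^*=\operatorname{diag}(\lambda_1^*,\dots,\lambda_m^* )$ with $\lambda_1^*\ge\dots\ge\lambda_m^*>0$. Let $\nu=\mathcal L(L^*W+R)$ and let $\nu_n\in\mathcal P_{2,0}(\mathbb R^d)$ with $\mathcal W_2(\nu_n,\nu)\to0$. Then for every $n$, $\mathcal D\cap\mathcal M^K_{\nu_n}\neq\emptyset$, and for any maximizers $\mu_{L_n}\in\operatorname{argmax}_{\mu\in\mathcal D\cap\mathcal M^K_{\nu_n}}\operatorname{Var}(\mu)$ with $L_n=U_n\Lambda_n^{1/2}$ (as in the definition of $\mathcal D$), $$L_nL_n^{\mathsf T}-\sigma_n^2U_nU_n^{\mathsf T}\to L^*{L^*}^{\mathsf T}\quad\text{and}\quad\sigma_n^2\to\sigma^2\qquad(n\to\infty),$$ where $\sigma_n^2=\frac1{d-m}\int|y-U_nU_n^{\mathsf T}y|^2\,d\nu_n(y)$.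
   Context: $\mathcal P_{2,0}(\mathbb R^d)$: Borel probability measures with finite second moment and zero mean; $\mathcal W_2$: quadratic Wasserstein distance; $\mathcal L(\cdot)$: law. $\operatorname{Var}(\mu)=\int|x-\int z\,d\mu|^2d\mu$. Gaussian factor domain: $\mathcal D=\{\mu_L=\mathcal L(LW):L=U\Lambda^{1/2}\}$ with $U\in\mathbb R^{d\times m}$ having orthonormal columns and $\Lambda=\operatorname{diag}(\lambda_1,\dots,\lambda_m)$, $\lambda_1\ge\dots\ge\lambda_m\ge0$. Kantorovich dominance: $\mu\preceq_K\nu$ iff there is a coupling $\pi$ of $\mu,\nu$ with $\int\langle x-b_\nu,y-x\rangle\,d\pi=0$, $b_\nu=\int y\,d\nu$; $\mathcal M^K_\nu=\{\mu\in\mathcal P_2(\mathbb R^d):\mu\preceq_K\nu\}$. *)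

theory Defs
  imports "HOL-Probability.Probability"
begin

definition P2 :: "('a::euclidean_space) measure \<Rightarrow> bool" where
  "P2 \<mu> \<longleftrightarrow> prob_space \<mu> \<and> sets \<mu> = sets borel \<and> integrable \<mu> (\<lambda>x. (norm x)^2)"

definition mean :: "('a::euclidean_space) measure \<Rightarrow> 'a" where
  "mean \<mu> = integral\<^sup>L \<mu> (\<lambda>x. x)"

definition P20 :: "('a::euclidean_space) measure \<Rightarrow> bool" where
  "P20 \<mu> \<longleftrightarrow> P2 \<mu> \<and> mean \<mu> = 0"

definition Var :: "('a::euclidean_space) measure \<Rightarrow> real" where
  "Var \<mu> = (\<integral>x. (norm (x - mean \<mu>))^2 \<partial>\<mu>)"

definition couplings :: "('a::euclidean_space) measure \<Rightarrow> ('b::euclidean_space) measure \<Rightarrow> ('a \<times> 'b) measure set" where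
  "couplings \<mu> \<nu> = {\<pi>. prob_space \<pi> \<and> sets \<pi> = sets (borel \<Otimes>\<^sub>M borel)
      \<and> distr \<pi> borel fst = \<mu> \<and> distr \<pi> borel snd = \<nu>}"

definition W2 :: "('a::euclidean_space) measure \<Rightarrow> 'a measure \<Rightarrow> real" where
  "W2 \<mu> \<nu> = sqrt (enn2real (INF \<pi>\<in>couplings \<mu> \<nu>. \<integral>\<^sup>+ p. ennreal ((dist (fst p) (snd p))^2) \<partial>\<pi>))"

definition K_dom :: "('a::euclidean_space) measure \<Rightarrow> 'a measure \<Rightarrow> bool" where
  "K_dom \<mu> \<nu> \<longleftrightarrow> (\<exists>\<pi>\<in>couplings \<mu> \<nu>.
      integrable \<pi> (\<lambda>p. (fst p - mean \<nu>) \<bullet> (snd p - fst p)) \<and>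
      (\<integral>p. (fst p - mean \<nu>) \<bullet> (snd p - fst p) \<partial>\<pi>) = 0)"

definition MK :: "('a::euclidean_space) measure \<Rightarrow> 'a measure set" where
  "MK \<nu> = {\<mu>. P2 \<mu> \<and> K_dom \<mu> \<nu>}"

definition gaussian :: "real \<Rightarrow> (real^'n::finite) measure" where
  "gaussian s = density lborel (\<lambda>x. ennreal (\<Prod>i\<in>UNIV. normal_density 0 s (x $ i)))"

abbreviation std_gaussian :: "(real^'n::finite) measure" where
  "std_gaussian \<equiv> gaussian 1"

definition orth_cols :: "real^'m^'d \<Rightarrow> bool" where
  "orth_cols U \<longleftrightarrow> transpose U ** U = mat 1"

definition diag_sqrt :: "real^'m \<Rightarrow> real^'m^'m" where
  "diag_sqrt lam = (\<chi> i j. if i = j then sqrt (lam $ i) else 0)"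

definition admissible_spec :: "real^('m::{finite,linorder}) \<Rightarrow> bool" where
  "admissible_spec lam \<longleftrightarrow> (\<forall>i. lam $ i \<ge> 0) \<and> (\<forall>i j. i \<le> j \<longrightarrow> lam $ j \<le> lam $ i)"

definition muL :: "real^('m::finite)^('d::finite) \<Rightarrow> (real^'d) measure" where
  "muL L = distr (std_gaussian :: (real^'m) measure) borel (\<lambda>w. L *v w)"

definition GD :: "('m::{finite,linorder}) itself \<Rightarrow> (real^('d::finite)) measure set" where
  "GD (_ :: 'm itself) = {muL (U ** diag_sqrt lam) | (U :: real^('m::{finite,linorder})^'d) lam.
           orth_cols U \<and> admissible_spec lam}"

end

theory Submission
  imports Defs
begin

text \<open>Write \<open>P = U U\<^sup>T\<close>, \<open>S\<^sub>n\<close> for the second moment matrix of \<open>\<nu>\<^sub>n\<close>, \<open>S\<close> for that of \<open>\<nu>\<close>, and use the trace inner product.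
  If \<open>X \<sim> \<mu>\<^sub>L\<close> and \<open>Y \<sim> \<nu>\<^sub>n\<close> are coupled with \<open>E \<langle>X, Y - X\<rangle> = 0\<close>, then \<open>P X = X\<close> gives
  \<open>E |X - P Y|\<^sup>2 = P \<bullet> S\<^sub>n - Var \<mu>\<^sub>L\<close>, so \<open>Var \<mu>\<^sub>L \<le> P \<bullet> S\<^sub>n\<close>, and the deficit controls the distance from \<open>L L\<^sup>T\<close> to
  \<open>P S\<^sub>n P\<close>. Conversely \<open>U\<^sup>* U\<^sup>*\<^sup>T Y\<close> with \<open>Y \<sim> \<nu>\<close> has a law in the Gaussian factor domain. Pairing \<open>Y\<close> with \<open>\<nu>\<^sub>n\<close> through an
  almost optimal coupling and rescaling by a factor \<open>c\<^sub>n \<rightarrow> 1\<close> gives a competitor of variance \<open>c\<^sub>n\<^sup>2 (P\<^sup>* \<bullet> S)\<close>. Hence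
  \<open>P\<^sub>n \<bullet> S\<close> tends to its maximum \<open>P\<^sup>* \<bullet> S\<close>, and the spectral gap of \<open>S\<close> forces \<open>P\<^sub>n \<rightarrow> P\<^sup>*\<close>.\<close>

subsection \<open>Centred Gaussian vectors\<close>

text \<open>Fubini for functions that factor over coordinates. \<open>lborel\<close> is the image of
  the product of one-dimensional Lebesgue measures indexed by \<open>Basis\<close>, so the work lies
  in translating a product over \<open>UNIV\<close> into one over \<open>Basis\<close>.\<close>

lemma
  fixes f :: "'n::finite \<Rightarrow> real \<Rightarrow> real"
  assumes f: "\<And>k. integrable lborel (f k)"
  shows integrable_lborel_prod_vec: "integrable lborel (\<lambda>x::real^'n. \<Prod>k\<in>UNIV. f k (x $ k))"
    and integral_lborel_prod_vec:
      "(\<integral>x. (\<Prod>k\<in>UNIV. f k ((x::real^'n) $ k)) \<partial>lborel) = (\<Prod>k\<in>UNIV. \<integral>x. f k x \<partial>lborel)"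
proof -
  \<comment> \<open>\<open>ix\<close> inverts \<open>k \<mapsto> axis k 1\<close>, giving each basis
    vector the factor that belongs to its coordinate.\<close>
  define ix :: "real^'n \<Rightarrow> 'n" where "ix b = (SOME k. b = axis k 1)" for b
  have ix: "ix (axis k 1) = k" for k
    unfolding ix_def by (auto simp: axis_eq_axis)
  have B: "(Basis :: (real^'n) set) = range (\<lambda>k. axis k 1)"
    by (auto simp: Basis_vec_def)
  have inj: "inj (\<lambda>k. axis k 1 :: real^'n)"
    by (auto simp: inj_on_def axis_eq_axis)
  have re: "(\<Prod>b\<in>Basis. G b) = (\<Prod>k\<in>UNIV. G (axis k 1))" for G :: "real^'n \<Rightarrow> real"
    unfolding B by (simp add: prod.reindex[OF inj])
  have eq: "(\<Prod>k\<in>UNIV. f k ((\<Sum>b\<in>Basis. u b *\<^sub>R b) $ k)) = (\<Prod>b\<in>Basis. f (ix b) (u b))"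
    for u :: "real^'n \<Rightarrow> real"
  proof -
    have "(\<Sum>b\<in>Basis. u b *\<^sub>R b) $ k = u (axis k 1)" for k
      unfolding B by (simp add: sum.reindex[OF inj]) (simp add: axis_def if_distrib sum.delta cong: if_cong)
    then show ?thesis
      unfolding re ix by simp
  qed
  interpret product_sigma_finite "\<lambda>_::real^'n. lborel :: real measure"
    by standard
  have [measurable]: "f k \<in> borel_measurable borel" for k
    using borel_measurable_integrable[OF f[of k]] by simp
  have p: "integrable (Pi\<^sub>M Basis (\<lambda>_::real^'n. lborel)) (\<lambda>u. \<Prod>b\<in>Basis. f (ix b) (u b))"
    by (rule product_integrable_prod) (auto intro: f)
  show "integrable lborel (\<lambda>x::real^'n. \<Prod>k\<in>UNIV. f k (x $ k))"
    by (subst lborel_eq, subst integrable_distr_eq) (measurable, simp only: eq p)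
  have "(\<integral>x. (\<Prod>k\<in>UNIV. f k ((x::real^'n) $ k)) \<partial>lborel)
      = (\<integral>u. (\<Prod>b\<in>Basis. f (ix b) (u b)) \<partial>Pi\<^sub>M Basis (\<lambda>_::real^'n. lborel))"
    by (subst lborel_eq, subst integral_distr) (measurable, simp only: eq)
  also have "\<dots> = (\<Prod>b\<in>(Basis::(real^'n) set). \<integral>x. f (ix b) x \<partial>lborel)"
    by (rule product_integral_prod) (auto intro: f)
  finally show "(\<integral>x. (\<Prod>k\<in>UNIV. f k ((x::real^'n) $ k)) \<partial>lborel) = (\<Prod>k\<in>UNIV. \<integral>x. f k x \<partial>lborel)"
    by (simp add: re ix)
qed

lemma sets_gaussian [simp, measurable_cong]: "sets (gaussian s) = sets borel"
  and space_gaussian [simp]: "space (gaussian s) = UNIV"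
  by (simp_all add: gaussian_def)

text \<open>The density factors over coordinates, so every mixed moment is a product of
  one-dimensional normal moments; the first and second moments below are read off from this.\<close>

lemma
  fixes a :: "'n::finite \<Rightarrow> nat"
  assumes s: "s > 0"
  shows integrable_gaussian_monomial:
      "integrable (gaussian s) (\<lambda>x::real^'n. \<Prod>k\<in>UNIV. (x $ k) ^ a k)"
    and integral_gaussian_monomial:
      "(\<integral>x. (\<Prod>k\<in>UNIV. ((x::real^'n) $ k) ^ a k) \<partial>gaussian s)
        = (\<Prod>k\<in>UNIV. \<integral>x. normal_density 0 s x * x ^ a k \<partial>lborel)"
proof -
  let ?f = "\<lambda>k x. normal_density 0 s x * x ^ a k"
  have i: "integrable lborel (?f k)" for k
    using integrable_normal_moment[OF s, of 0 "a k"] by simp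
  show "integrable (gaussian s) (\<lambda>x::real^'n. \<Prod>k\<in>UNIV. (x $ k) ^ a k)"
    unfolding gaussian_def using integrable_lborel_prod_vec[of ?f, OF i]
    by (subst integrable_density) (auto simp: prod.distrib intro!: prod_nonneg)
  show "(\<integral>x. (\<Prod>k\<in>UNIV. ((x::real^'n) $ k) ^ a k) \<partial>gaussian s)
        = (\<Prod>k\<in>UNIV. \<integral>x. normal_density 0 s x * x ^ a k \<partial>lborel)"
    unfolding gaussian_def using integral_lborel_prod_vec[of ?f, OF i]
    by (subst integral_density) (auto simp: prod.distrib intro!: prod_nonneg)
qed

lemma prob_space_gaussian:
  assumes s: "s > 0"
  shows "prob_space (gaussian s :: (real^'n::finite) measure)"
proof
  have "(\<integral>\<^sup>+x. ennreal (\<Prod>i\<in>UNIV. normal_density 0 s ((x::real^'n) $ i)) \<partial>lborel) = 1"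
    using integrable_lborel_prod_vec[of "\<lambda>_::'n. normal_density 0 s"]
      integral_lborel_prod_vec[of "\<lambda>_::'n. normal_density 0 s"] s
    by (subst nn_integral_eq_integral) (auto intro!: prod_nonneg)
  then show "emeasure (gaussian s) (space (gaussian s :: (real^'n) measure)) = 1"
    by (simp add: gaussian_def emeasure_density)
qed

lemma
  assumes s: "s > 0"
  shows integrable_gaussian_nth: "integrable (gaussian s) (\<lambda>x::real^'n::finite. x $ i)"
    and integral_gaussian_nth: "(\<integral>x. (x::real^'n) $ i \<partial>gaussian s) = 0"
proof -
  \<comment> \<open>A single coordinate is the monomial with exponent 1 at \<open>i\<close> and 0
    elsewhere; its factor at \<open>i\<close> is the vanishing first moment.\<close>
  have p: "(\<Prod>k\<in>UNIV. (x $ k) ^ (if k = i then 1 else 0)) = x $ i" for x :: "real^'n"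
    by (simp add: if_distrib prod.delta cong: if_cong)
  note I = integrable_gaussian_monomial[OF s, of "\<lambda>k. if k = i then 1 else 0"]
    integral_gaussian_monomial[OF s, of "\<lambda>k. if k = i then 1 else 0"]
  show "integrable (gaussian s) (\<lambda>x::real^'n. x $ i)"
    using I(1) unfolding p .
  have "(\<integral>x. normal_density 0 s x * x \<partial>lborel) = 0"
    using integral_normal_moment_nz_1[OF s, of 0] by simp
  then show "(\<integral>x. (x::real^'n) $ i \<partial>gaussian s) = 0"
    using I(2) unfolding p by (auto intro!: prod_zero bexI[of _ i])
qed

lemma
  assumes s: "s > 0"
  shows integrable_gaussian_nth_mult: "integrable (gaussian s) (\<lambda>x::real^'n::finite. x $ i * x $ j)"
    and integral_gaussian_nth_mult:
      "(\<integral>x. (x::real^'n) $ i * x $ j \<partial>gaussian s) = (if i = j then s\<^sup>2 else 0)"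
proof -
  \<comment> \<open>The exponents of \<open>x $ i * x $ j\<close>: a single 2 when
    \<open>i = j\<close>, otherwise two 1s, each of which contributes a vanishing first
    moment.\<close>
  define a where "a k = (if k = i then 1 else 0) + (if k = j then 1 else 0 :: nat)" for k
  have p: "(\<Prod>k\<in>UNIV. (x $ k) ^ a k) = x $ i * x $ j" for x :: "real^'n"
    unfolding a_def power_add prod.distrib if_distrib[of "\<lambda>m. y ^ m" for y :: real]
    unfolding power_one_right power_0 by (simp add: prod.delta)
  note I = integrable_gaussian_monomial[OF s, of a] integral_gaussian_monomial[OF s, of a]
  show "integrable (gaussian s) (\<lambda>x::real^'n. x $ i * x $ j)"
    using I(1) unfolding p .
  have m1: "(\<integral>x. normal_density 0 s x * x \<partial>lborel) = 0"
    using integral_normal_moment_nz_1[OF s, of 0] by simp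
  have m2: "(\<integral>x. normal_density 0 s x * x\<^sup>2 \<partial>lborel) = s\<^sup>2"
    using integral_normal_moment_even[OF s, of 0 1] s by (simp add: fact_numeral)
  show "(\<integral>x. (x::real^'n) $ i * x $ j \<partial>gaussian s) = (if i = j then s\<^sup>2 else 0)"
  proof (cases "i = j")
    case True
    have "(\<integral>x. normal_density 0 s x * x ^ a k \<partial>lborel) = (if k = i then s\<^sup>2 else 1)" for k
      using m2 s by (simp add: a_def True numeral_2_eq_2)
    then show ?thesis
      using I(2) unfolding p by (simp add: True prod.delta)
  next
    case False
    then have "(\<integral>x. normal_density 0 s x * x ^ a i \<partial>lborel) = 0"
      using m1 by (simp add: a_def)
    then show ?thesis
      using I(2) False unfolding p by (auto intro!: prod_zero bexI[of _ i])
  qed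
qed

text \<open>The density depends on \<open>x\<close> only through its norm, so invariance of a
  Gaussian density reduces to invariance of a quadratic form.\<close>

lemma prod_normal_density_vec:
  "(\<Prod>i\<in>UNIV. normal_density 0 s ((x::real^'n::finite) $ i))
    = (1 / sqrt (2 * pi * s\<^sup>2)) ^ CARD('n) * exp (- (norm x)\<^sup>2 / (2 * s\<^sup>2))"
proof -
  have "(\<Prod>i\<in>UNIV. exp (- (x $ i)\<^sup>2 / (2 * s\<^sup>2))) = exp (- (norm x)\<^sup>2 / (2 * s\<^sup>2))"
    by (simp add: exp_sum[symmetric] sum_divide_distrib[symmetric] sum_negf norm_vec_def L2_set_def sum_nonneg)
  then show ?thesis
    by (simp add: normal_density_def prod_dividef power_divide)
qed

subsection \<open>Laws of linear images of a Gaussian\<close>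

lemma nn_integral_lborel_iterated:
  fixes F :: "'a::euclidean_space \<times> 'b::euclidean_space \<Rightarrow> ennreal"
  assumes "F \<in> borel_measurable (borel \<Otimes>\<^sub>M borel)"
  shows "(\<integral>\<^sup>+p. F p \<partial>lborel) = (\<integral>\<^sup>+a. (\<integral>\<^sup>+b. F (a, b) \<partial>lborel) \<partial>lborel)"
  using assms lborel.nn_integral_fst[of F lborel]
  by (simp add: lborel_prod borel_prod)

text \<open>For a fixed first coordinate a shear is a translation of the second, and Lebesgue
  measure is translation invariant. No determinant is involved.\<close>

lemma nn_integral_lborel_shear_snd:
  fixes S :: "'a::euclidean_space \<Rightarrow> 'b::euclidean_space"
  assumes [measurable]: "S \<in> borel_measurable borel" "F \<in> borel_measurable (borel \<Otimes>\<^sub>M borel)"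
  shows "(\<integral>\<^sup>+p. F (fst p, snd p + S (fst p)) \<partial>lborel) = (\<integral>\<^sup>+p. F p \<partial>lborel)"
proof -
  have tr: "(\<integral>\<^sup>+b. F (a, b + S a) \<partial>lborel) = (\<integral>\<^sup>+b. F (a, b) \<partial>lborel)" for a
  proof -
    have "(\<integral>\<^sup>+b. F (a, b) \<partial>lborel) = (\<integral>\<^sup>+b. F (a, b) \<partial>distr lborel borel ((+) (S a)))"
      by (simp add: lborel_distr_plus)
    also have "\<dots> = (\<integral>\<^sup>+b. F (a, S a + b) \<partial>lborel)"
      by (subst nn_integral_distr) simp_all
    finally show ?thesis by (simp add: add.commute)
  qed
  show ?thesis
    by (subst (1 2) nn_integral_lborel_iterated) (measurable, simp add: tr)
qed

lemma nn_integral_lborel_shear_fst: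
  fixes S :: "'b::euclidean_space \<Rightarrow> 'a::euclidean_space"
  assumes [measurable]: "S \<in> borel_measurable borel" "F \<in> borel_measurable (borel \<Otimes>\<^sub>M borel)"
  shows "(\<integral>\<^sup>+p. F (fst p + S (snd p), snd p) \<partial>lborel) = (\<integral>\<^sup>+p. F p \<partial>lborel)"
proof -
  have tr: "(\<integral>\<^sup>+a. F (a + S b, b) \<partial>lborel) = (\<integral>\<^sup>+a. F (a, b) \<partial>lborel)" for b
  proof -
    have "(\<integral>\<^sup>+a. F (a, b) \<partial>lborel) = (\<integral>\<^sup>+a. F (a, b) \<partial>distr lborel borel ((+) (S b)))"
      by (simp add: lborel_distr_plus)
    also have "\<dots> = (\<integral>\<^sup>+a. F (S b + a, b) \<partial>lborel)"
      by (subst nn_integral_distr) simp_all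
    finally show ?thesis by (simp add: add.commute)
  qed
  have "(\<integral>\<^sup>+p. F (fst p + S (snd p), snd p) \<partial>(lborel \<Otimes>\<^sub>M lborel)) = (\<integral>\<^sup>+b. (\<integral>\<^sup>+a. F (a + S b, b) \<partial>lborel) \<partial>lborel)"
    by (subst lborel_pair.nn_integral_snd[symmetric]) (simp_all add: split_beta)
  also have "\<dots> = (\<integral>\<^sup>+b. (\<integral>\<^sup>+a. F (a, b) \<partial>lborel) \<partial>lborel)"
    by (simp add: tr)
  also have "\<dots> = (\<integral>\<^sup>+p. F p \<partial>(lborel \<Otimes>\<^sub>M lborel))"
    by (subst lborel_pair.nn_integral_snd[symmetric]) (simp_all add: split_beta)
  finally show ?thesis by (simp add: lborel_prod)
qed

text \<open>The map \<open>(z, x) \<mapsto> (T x, x - A (T x) - A z)\<close> is a composition of three shears, hence it preserves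
  Lebesgue measure. If it also preserves the product density \<open>g \<otimes> h\<close>, comparing first marginals
  identifies the law of \<open>T\<close> under \<open>h\<close>.\<close>

lemma distr_coisometry:
  fixes T :: "'e::euclidean_space \<Rightarrow> 'f::euclidean_space" and A :: "'f \<Rightarrow> 'e"
  assumes T: "linear T" and A: "linear A" and TA: "\<And>z. T (A z) = z"
    and g[measurable]: "g \<in> borel_measurable borel" and h[measurable]: "h \<in> borel_measurable borel"
    and gp: "prob_space (density lborel g)" and hp: "prob_space (density lborel h)"
    and inv: "\<And>z x. g (T x) * h (x - A (T x) - A z) = g z * h x"
  shows "distr (density lborel h) borel (T) = density lborel g"
proof -
  have [measurable]: "T \<in> borel_measurable borel" "A \<in> borel_measurable borel"
    using T A by (auto intro!: borel_measurable_continuous_onI linear_continuous_on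
        simp: linear_conv_bounded_linear)
  have g1: "(\<integral>\<^sup>+z. g z \<partial>lborel) = 1"
    using prob_space.emeasure_space_1[OF gp] by (simp add: emeasure_density)
  have h1: "(\<integral>\<^sup>+x. h x \<partial>lborel) = 1"
    using prob_space.emeasure_space_1[OF hp] by (simp add: emeasure_density)
  show ?thesis
  proof (rule measure_eqI)
    fix B assume "B \<in> sets (distr (density lborel h) borel (T))"
    then have B[measurable]: "B \<in> sets borel" by simp
    define \<phi> :: "'f \<Rightarrow> ennreal" where "\<phi> = indicator B"
    have [measurable]: "\<phi> \<in> borel_measurable borel"
      by (simp add: \<phi>_def)
    define F where "F p = \<phi> (fst p) * (g (fst p) * h (snd p))" for p
    have [measurable]: "F \<in> borel_measurable (borel \<Otimes>\<^sub>M borel)"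
      unfolding F_def by measurable
    \<comment> \<open>\<open>F1\<close> and \<open>F2\<close> absorb one shear each, the third being
      applied in \<open>F3\<close>. There \<open>T (A z) = z\<close> cancels \<open>z\<close> in the
      first slot and leaves \<open>T x\<close>.\<close>
    define F1 where "F1 p = F (fst p, snd p + (- A (fst p)))" for p
    have [measurable]: "F1 \<in> borel_measurable (borel \<Otimes>\<^sub>M borel)"
      unfolding F1_def by measurable
    define F2 where "F2 p = F1 (fst p + T (snd p), snd p)" for p
    have [measurable]: "F2 \<in> borel_measurable (borel \<Otimes>\<^sub>M borel)"
      unfolding F2_def by measurable
    have F3: "F2 (fst p, snd p + (- A (fst p))) = F (T (snd p), snd p - A (T (snd p)) - A (fst p))" for p
      by (simp add: F2_def F1_def linear_add[OF T] linear_add[OF A] linear_diff[OF T] TA algebra_simps)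
    have Fi: "F (T x, x - A (T x) - A z) = g z * (\<phi> (T x) * h x)" for x z
      using inv[of x z] by (simp add: F_def mult_ac)
    \<comment> \<open>The auxiliary variable \<open>z\<close> enters through the total mass 1 of
      \<open>g\<close>; after the change of variables \<open>x\<close> leaves through the total mass
      1 of \<open>h\<close>.\<close>
    have "(\<integral>\<^sup>+x. h x * \<phi> (T x) \<partial>lborel)
        = (\<integral>\<^sup>+z. (\<integral>\<^sup>+x. g z * (\<phi> (T x) * h x) \<partial>lborel) \<partial>lborel)"
      by (simp add: nn_integral_cmult nn_integral_multc g1 mult.commute)
    also have "\<dots> = (\<integral>\<^sup>+p. F2 (fst p, snd p + (- A (fst p))) \<partial>lborel)"
      unfolding F3 by (subst nn_integral_lborel_iterated) (measurable, simp add: Fi)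
    also have "\<dots> = (\<integral>\<^sup>+p. F2 p \<partial>lborel)"
      by (rule nn_integral_lborel_shear_snd) measurable
    also have "\<dots> = (\<integral>\<^sup>+p. F1 p \<partial>lborel)"
      unfolding F2_def by (rule nn_integral_lborel_shear_fst) measurable
    also have "\<dots> = (\<integral>\<^sup>+p. F p \<partial>lborel)"
      unfolding F1_def by (rule nn_integral_lborel_shear_snd) measurable
    also have "\<dots> = (\<integral>\<^sup>+z. (\<integral>\<^sup>+x. \<phi> z * (g z * h x) \<partial>lborel) \<partial>lborel)"
      unfolding F_def by (subst nn_integral_lborel_iterated) simp_all
    also have "\<dots> = (\<integral>\<^sup>+z. g z * \<phi> z \<partial>lborel)"
      by (simp add: nn_integral_cmult h1 mult.commute)
    finally show "emeasure (distr (density lborel h) borel (T)) B = emeasure (density lborel g) B"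
      by (simp add: emeasure_distr emeasure_density \<phi>_def indicator_def vimage_def)
  qed simp
qed

lemma diag_sqrt_mult_vec: "(diag_sqrt lam *v w) $ k = sqrt (lam $ k) * w $ k"
  by (simp add: diag_sqrt_def matrix_vector_mult_def if_distrib[of "\<lambda>x. x * _"] cong: if_cong)

lemma borel_measurable_matrix_vector_mult [measurable (raw)]:
  fixes f :: "'a \<Rightarrow> real^'n::finite"
  assumes "f \<in> borel_measurable M"
  shows "(\<lambda>x. A *v f x) \<in> borel_measurable M"
  by (rule measurable_compose[OF assms])
    (intro borel_measurable_continuous_onI matrix_vector_mult_linear_continuous_on)

lemma borel_measurable_nth [measurable (raw)]:
  fixes f :: "'a \<Rightarrow> real^'n::finite"
  assumes "f \<in> borel_measurable M"
  shows "(\<lambda>x. f x $ i) \<in> borel_measurable M"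
  by (rule measurable_compose[OF assms])
    (intro borel_measurable_continuous_onI continuous_intros)

text \<open>Since \<open>transpose U ** U = mat 1\<close>, coordinate k of the image is
  \<open>sqrt (lam $ k)\<close> times a standard normal plus independent noise of variance
  \<open>\<sigma>\<^sup>2\<close>. Dividing by the joint standard deviation gives a coisometry for
  the form in the exponent of the joint density, so \<open>distr_coisometry\<close> applies;
  multiplying back restores the scale.\<close>

lemma gaussian_signal_plus_noise:
  fixes U :: "real^'m::finite^'d::finite"
  assumes U: "orth_cols U" and \<sigma>: "\<sigma> > 0" and lam: "\<And>k. lam $ k \<ge> 0"
  shows "distr (std_gaussian \<Otimes>\<^sub>M gaussian \<sigma>) borel
           (\<lambda>p. transpose U *v ((U ** diag_sqrt lam) *v fst p + snd p))
         = distr std_gaussian borel (\<lambda>w. diag_sqrt (\<chi> k. lam $ k + \<sigma>\<^sup>2) *v w)"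
proof -
  define D where "D k = sqrt (lam $ k + \<sigma>\<^sup>2)" for k
  have D: "D k > 0" "D k * D k = lam $ k + \<sigma>\<^sup>2" for k
    using lam[of k] \<sigma> by (auto simp: D_def add_nonneg_pos)
  \<comment> \<open>\<open>T\<close> is the projected signal plus noise with every coordinate
    normalised to variance 1, and \<open>A\<close> is its adjoint with respect to the form
    \<open>Q\<close> below (see \<open>QA\<close>).\<close>
  define T :: "(real^'m) \<times> (real^'d) \<Rightarrow> real^'m"
    where "T p = (\<chi> k. (sqrt (lam $ k) * fst p $ k + (transpose U *v snd p) $ k) / D k)" for p
  define A :: "real^'m \<Rightarrow> (real^'m) \<times> (real^'d)"
    where "A z = ((\<chi> k. sqrt (lam $ k) * z $ k / D k), \<sigma>\<^sup>2 *\<^sub>R (U *v (\<chi> k. z $ k / D k)))" for z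
  have UU: "transpose U *v (U *v v) = v" for v
    using U by (simp add: orth_cols_def matrix_vector_mul_assoc del: transpose_matrix_vector)
  have lT: "linear T"
    by (rule linearI) (auto simp: T_def vec_eq_iff matrix_vector_mult_add_rdistrib
        matrix_vector_right_distrib matrix_vector_mult_scaleR add_divide_distrib ring_distribs mult_ac)
  have e1: "(\<chi> k. (v + w) $ k / D k) = (\<chi> k. v $ k / D k) + (\<chi> k. w $ k / D k)" for v w :: "real^'m"
    by (simp add: vec_eq_iff add_divide_distrib)
  have e2: "(\<chi> k. (c *\<^sub>R v) $ k / D k) = c *\<^sub>R (\<chi> k. v $ k / D k)" for c and v :: "real^'m"
    by (simp add: vec_eq_iff)
  have lA: "linear A"
  proof (rule linearI)
    show "A (v + w) = A v + A w" for v w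
      unfolding A_def e1 by (simp add: matrix_vector_right_distrib scaleR_right_distrib vec_eq_iff
          ring_distribs add_divide_distrib)
    show "A (c *\<^sub>R v) = c *\<^sub>R A v" for c v
      unfolding A_def e2 by (simp add: matrix_vector_mult_scaleR vec_eq_iff mult_ac)
  qed
  have TA: "T (A z) = z" for z
  proof -
    have "(lam $ k * z $ k / D k + \<sigma>\<^sup>2 * (z $ k / D k)) / D k = z $ k" for k
    proof -
      have "(lam $ k * z $ k / D k + \<sigma>\<^sup>2 * (z $ k / D k)) / D k = z $ k * (lam $ k + \<sigma>\<^sup>2) / (D k * D k)"
        using D(1)[of k] by (simp add: field_simps)
      moreover have "lam $ k + \<sigma>\<^sup>2 > 0"
        using lam[of k] \<sigma> by (simp add: add_nonneg_pos)
      ultimately show ?thesis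
        using D(2)[of k] by simp
    qed
    then show ?thesis
      using lam by (simp add: T_def A_def UU matrix_vector_mult_scaleR vec_eq_iff
          mult.assoc[symmetric] real_sqrt_mult_self del: transpose_matrix_vector)
  qed
  \<comment> \<open>The joint density is a constant times \<open>exp (- Q p p / 2)\<close>.\<close>
  define Q where "Q x y = fst x \<bullet> fst y + snd x \<bullet> snd y / \<sigma>\<^sup>2" for x y :: "(real^'m) \<times> (real^'d)"
  have QA: "Q x (A z) = T x \<bullet> z" for x z
  proof -
    have "Q x (A z) = fst x \<bullet> (\<chi> k. sqrt (lam $ k) * z $ k / D k)
        + snd x \<bullet> (U *v (\<chi> k. z $ k / D k))"
      using \<sigma> by (simp add: Q_def A_def)
    also have "snd x \<bullet> (U *v (\<chi> k. z $ k / D k)) = (transpose U *v snd x) \<bullet> (\<chi> k. z $ k / D k)"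
      by (simp add: dot_lmul_matrix[symmetric])
    finally show ?thesis
      by (simp add: T_def inner_vec_def sum.distrib[symmetric] ring_distribs add_divide_distrib mult_ac)
  qed
  have Qsym: "Q x y = Q y x" for x y
    by (simp add: Q_def inner_commute)
  have Qadd: "Q (x - y) (x - y) = Q x x - 2 * Q x y + Q y y" for x y
    using \<sigma> by (simp add: Q_def inner_diff_left inner_diff_right inner_commute diff_divide_distrib add_divide_distrib)
  \<comment> \<open>The required invariance in exponents. Write the argument as
    \<open>x - A (T x + z)\<close> and expand: by adjointness the cross term is
    \<open>T x \<bullet> (T x + z)\<close>, and by \<open>TA\<close> the form \<open>Q\<close> of
    \<open>A w\<close> is the squared norm of \<open>w\<close>.\<close>
  have key: "(norm (T x))\<^sup>2 + Q (x - A (T x) - A z) (x - A (T x) - A z) = (norm z)\<^sup>2 + Q x x" for x z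
  proof -
    have e: "x - A (T x) - A z = x - A (T x + z)"
      by (simp add: linear_add[OF lA])
    show ?thesis
      unfolding e by (simp add: Qadd QA TA power2_norm_eq_inner inner_add_left inner_add_right inner_commute)
  qed
  define g :: "real^'m \<Rightarrow> ennreal" where "g z = ennreal (\<Prod>i\<in>UNIV. normal_density 0 1 (z $ i))" for z
  define h1 :: "real^'d \<Rightarrow> ennreal" where "h1 r = ennreal (\<Prod>i\<in>UNIV. normal_density 0 \<sigma> (r $ i))" for r
  define h where "h p = g (fst p) * h1 (snd p)" for p
  have [measurable]: "g \<in> borel_measurable borel" "h1 \<in> borel_measurable borel"
    unfolding g_def h1_def by measurable
  have hm: "h \<in> borel_measurable borel"
    unfolding h_def borel_prod[symmetric] by measurable
  interpret G1: prob_space "std_gaussian :: (real^'m) measure"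
    by (rule prob_space_gaussian) simp
  interpret G2: prob_space "gaussian \<sigma> :: (real^'d) measure"
    by (rule prob_space_gaussian) fact
  interpret G: pair_prob_space "std_gaussian :: (real^'m) measure" "gaussian \<sigma> :: (real^'d) measure" ..
  have dg: "density lborel g = std_gaussian"
    by (simp add: gaussian_def g_def[abs_def])
  have dh1: "density lborel h1 = gaussian \<sigma>"
    by (simp add: gaussian_def h1_def[abs_def])
  have dh: "density lborel h = std_gaussian \<Otimes>\<^sub>M gaussian \<sigma>"
    unfolding dg[symmetric] dh1[symmetric]
    by (subst pair_measure_density)
      (auto simp: lborel.sigma_finite_measure_axioms dh1 G2.sigma_finite_measure_axioms lborel_prod
        h_def[abs_def] split_def)
  define c1 c2 where "c1 = (1 / sqrt (2 * pi)) ^ CARD('m)" and "c2 = (1 / sqrt (2 * pi * \<sigma>\<^sup>2)) ^ CARD('d)"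
  have c: "c1 \<ge> 0" "c2 \<ge> 0" by (simp_all add: c1_def c2_def)
  have g_eq: "g z = ennreal (c1 * exp (- (norm z)\<^sup>2 / 2))" for z
    by (simp add: g_def prod_normal_density_vec c1_def)
  have h1_eq: "h1 r = ennreal (c2 * exp (- (norm r)\<^sup>2 / (2 * \<sigma>\<^sup>2)))" for r
    by (simp add: h1_def prod_normal_density_vec c2_def)
  have h_eq: "h p = ennreal (c1 * c2 * exp (- Q p p / 2))" for p
  proof -
    have "exp (- (norm (fst p))\<^sup>2 / 2) * exp (- (norm (snd p))\<^sup>2 / (2 * \<sigma>\<^sup>2)) = exp (- Q p p / 2)"
      using \<sigma> by (simp add: exp_add[symmetric] Q_def power2_norm_eq_inner field_simps)
    then show ?thesis
      using c by (simp add: h_def g_eq h1_eq ennreal_mult[symmetric] mult_ac)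
  qed
  have inv: "g (T x) * h (x - A (T x) - A z) = g z * h x" for z x
  proof -
    have e: "exp (- (norm (T x))\<^sup>2 / 2) * exp (- Q (x - A (T x) - A z) (x - A (T x) - A z) / 2)
        = exp (- (norm z)\<^sup>2 / 2) * exp (- Q x x / 2)"
      using key[of x z] by (simp add: exp_add[symmetric] field_simps)
    have "g u * h v = ennreal (c1 * c1 * c2 * (exp (- (norm u)\<^sup>2 / 2) * exp (- Q v v / 2)))" for u v
      using c by (simp add: g_eq h_eq ennreal_mult[symmetric] mult_ac)
    then show ?thesis
      by (simp only: e)
  qed
  have law: "distr (std_gaussian \<Otimes>\<^sub>M gaussian \<sigma>) borel T = std_gaussian"
    using distr_coisometry[OF lT lA TA _ hm _ _ inv] G.P.prob_space_axioms G1.prob_space_axioms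
    by (simp add: dg dh)
  have [measurable]: "T \<in> borel_measurable (borel \<Otimes>\<^sub>M borel)"
    unfolding borel_prod using lT by (auto intro!: borel_measurable_continuous_onI linear_continuous_on
        simp: linear_conv_bounded_linear)
  have "transpose U *v ((U ** diag_sqrt lam) *v fst p + snd p)
      = diag_sqrt (\<chi> k. lam $ k + \<sigma>\<^sup>2) *v T p" for p
    using D(1) by (simp add: vec_eq_iff diag_sqrt_mult_vec matrix_vector_right_distrib UU T_def
        matrix_vector_mul_assoc[symmetric] D_def[symmetric] less_imp_neq[symmetric]
        del: transpose_matrix_vector)
  then have "distr (std_gaussian \<Otimes>\<^sub>M gaussian \<sigma>) borel
           (\<lambda>p. transpose U *v ((U ** diag_sqrt lam) *v fst p + snd p))
      = distr (distr (std_gaussian \<Otimes>\<^sub>M gaussian \<sigma>) borel T) borel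
          (\<lambda>w. diag_sqrt (\<chi> k. lam $ k + \<sigma>\<^sup>2) *v w)"
    by (subst distr_distr) (simp_all add: comp_def)
  then show ?thesis
    by (simp add: law)
qed

subsection \<open>Second moments\<close>

lemma integrable_inner_of_squares:
  fixes X Y :: "'a \<Rightarrow> 'b::euclidean_space"
  assumes [measurable]: "X \<in> borel_measurable M" "Y \<in> borel_measurable M"
    and "integrable M (\<lambda>x. (norm (X x))\<^sup>2)" "integrable M (\<lambda>x. (norm (Y x))\<^sup>2)"
  shows "integrable M (\<lambda>x. X x \<bullet> Y x)" "integrable M (\<lambda>x. norm (X x) * norm (Y x))"
    "integrable M (\<lambda>x. (norm (X x - Y x))\<^sup>2)"
proof -
  have i: "integrable M (\<lambda>x. (norm (X x))\<^sup>2 + (norm (Y x))\<^sup>2)"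
    using assms by (rule_tac Bochner_Integration.integrable_add)
  have b: "norm x * norm y \<le> (norm x)\<^sup>2 + (norm y)\<^sup>2" for x y :: 'b
    using zero_le_power2[of "norm x - norm y"] mult_nonneg_nonneg[OF norm_ge_zero[of x] norm_ge_zero[of y]]
    unfolding power2_diff mult.assoc by linarith
  show 1: "integrable M (\<lambda>x. norm (X x) * norm (Y x))"
    by (rule Bochner_Integration.integrable_bound[OF i]) (auto intro!: AE_I2 order_trans[OF b] simp: abs_mult)
  show 2: "integrable M (\<lambda>x. X x \<bullet> Y x)"
    by (rule Bochner_Integration.integrable_bound[OF 1]) (auto intro!: AE_I2 simp: Cauchy_Schwarz_ineq2)
  have e: "(norm (x - y))\<^sup>2 = (norm x)\<^sup>2 + (norm y)\<^sup>2 - 2 * (x \<bullet> y)" for x y :: 'b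
    by (simp add: power2_norm_eq_inner inner_diff_left inner_diff_right inner_commute)
  show "integrable M (\<lambda>x. (norm (X x - Y x))\<^sup>2)"
    unfolding e using i 2 by auto
qed

lemma integral_norm_mult_le:
  fixes X Y :: "'a \<Rightarrow> 'b::euclidean_space"
  assumes [measurable]: "X \<in> borel_measurable M" "Y \<in> borel_measurable M"
    and X: "integrable M (\<lambda>x. (norm (X x))\<^sup>2)" and Y: "integrable M (\<lambda>x. (norm (Y x))\<^sup>2)"
  shows "(\<integral>x. norm (X x) * norm (Y x) \<partial>M)
          \<le> sqrt (\<integral>x. (norm (X x))\<^sup>2 \<partial>M) * sqrt (\<integral>x. (norm (Y x))\<^sup>2 \<partial>M)"
proof -
  let ?a = "\<integral>x. (norm (X x))\<^sup>2 \<partial>M" and ?b = "\<integral>x. (norm (Y x))\<^sup>2 \<partial>M"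
  let ?c = "\<integral>x. norm (X x) * norm (Y x) \<partial>M"
  have "(\<integral>\<^sup>+x. ennreal (norm (X x)) * ennreal (norm (Y x)) \<partial>M) = ennreal ?c"
    using integrable_inner_of_squares(2)[OF assms] by (simp add: ennreal_mult[symmetric] nn_integral_eq_integral)
  moreover have "(\<integral>\<^sup>+x. (ennreal (norm (X x)))\<^sup>2 \<partial>M) = ennreal ?a"
    using X by (simp add: ennreal_power nn_integral_eq_integral)
  moreover have "(\<integral>\<^sup>+x. (ennreal (norm (Y x)))\<^sup>2 \<partial>M) = ennreal ?b"
    using Y by (simp add: ennreal_power nn_integral_eq_integral)
  ultimately have "(ennreal ?c)\<^sup>2 \<le> ennreal ?a * ennreal ?b"
    using Cauchy_Schwarz_nn_integral[of "\<lambda>x. ennreal (norm (X x))" M "\<lambda>x. ennreal (norm (Y x))"] by simp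
  then have "?c\<^sup>2 \<le> ?a * ?b"
    by (simp add: ennreal_power ennreal_mult[symmetric])
  then have "?c \<le> sqrt (?a * ?b)"
    by (rule real_le_rsqrt)
  then show ?thesis
    by (simp add: real_sqrt_mult)
qed

lemma abs_integral_inner_le:
  fixes X Y :: "'a \<Rightarrow> 'b::euclidean_space"
  assumes [measurable]: "X \<in> borel_measurable M" "Y \<in> borel_measurable M"
    and X: "integrable M (\<lambda>x. (norm (X x))\<^sup>2)" and Y: "integrable M (\<lambda>x. (norm (Y x))\<^sup>2)"
  shows "\<bar>\<integral>x. X x \<bullet> Y x \<partial>M\<bar> \<le> sqrt (\<integral>x. (norm (X x))\<^sup>2 \<partial>M) * sqrt (\<integral>x. (norm (Y x))\<^sup>2 \<partial>M)"
proof -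
  have "\<bar>\<integral>x. X x \<bullet> Y x \<partial>M\<bar> \<le> (\<integral>x. norm (X x) * norm (Y x) \<partial>M)"
    using integral_norm_bound[of M "\<lambda>x. X x \<bullet> Y x"] integrable_inner_of_squares[OF assms]
    by (auto intro!: order_trans[OF integral_abs_bound] integral_mono simp: Cauchy_Schwarz_ineq2)
  then show ?thesis
    using integral_norm_mult_le[OF assms] by simp
qed

text \<open>Stability of second moments under mean square perturbation: writing
  \<open>x = y + (x - y)\<close> leaves one term quadratic and two terms linear in the difference,
  and Cauchy-Schwarz bounds the latter. It serves both for Wasserstein convergence and for the
  deficit bound under dominance.\<close>

lemma abs_integral_nth_mult_diff_le:
  fixes X Y :: "'a \<Rightarrow> real^'d::finite"
  assumes [measurable]: "X \<in> borel_measurable M" "Y \<in> borel_measurable M"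
    and X: "integrable M (\<lambda>x. (norm (X x))\<^sup>2)" and Y: "integrable M (\<lambda>x. (norm (Y x))\<^sup>2)"
  shows "\<bar>(\<integral>x. X x $ i * X x $ j \<partial>M) - (\<integral>x. Y x $ i * Y x $ j \<partial>M)\<bar>
    \<le> (\<integral>x. (norm (X x - Y x))\<^sup>2 \<partial>M)
       + 2 * (sqrt (\<integral>x. (norm (X x - Y x))\<^sup>2 \<partial>M) * sqrt (\<integral>x. (norm (Y x))\<^sup>2 \<partial>M))"
proof -
  have ij: "integrable M (\<lambda>x. Z x $ i * Z x $ j)"
    if [measurable]: "Z \<in> borel_measurable M" and Z: "integrable M (\<lambda>x. (norm (Z x))\<^sup>2)"
    for Z :: "'a \<Rightarrow> real^'d"
  proof (rule Bochner_Integration.integrable_bound[OF Z])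
    show "AE x in M. norm (Z x $ i * Z x $ j) \<le> norm ((norm (Z x))\<^sup>2)"
      by (auto intro!: AE_I2 mult_mono component_le_norm_cart simp: abs_mult power2_eq_square)
  qed measurable
  note D = integrable_inner_of_squares(3)[OF assms]
  have DY: "integrable M (\<lambda>x. norm (X x - Y x) * norm (Y x))"
    by (rule integrable_inner_of_squares(2)) (use D Y in measurable)
  have pt: "\<bar>x $ i * x $ j - y $ i * y $ j\<bar> \<le> (norm (x - y))\<^sup>2 + 2 * (norm (x - y) * norm y)" for x y :: "real^'d"
  proof -
    have "x $ i * x $ j - y $ i * y $ j
        = (x - y) $ i * (x - y) $ j + (x - y) $ i * y $ j + y $ i * (x - y) $ j"
      by (simp add: algebra_simps)
    moreover have "\<bar>u $ i * v $ j\<bar> \<le> norm u * norm v" "\<bar>u $ j * v $ i\<bar> \<le> norm u * norm v" for u v :: "real^'d"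
      by (auto intro!: mult_mono component_le_norm_cart simp: abs_mult)
    note this(1)[of "x - y" "x - y"] this(1)[of "x - y" y] this(1)[of y "x - y"]
    ultimately show ?thesis
      by (simp add: power2_eq_square mult.commute[of "norm y"])
  qed
  have "\<bar>(\<integral>x. X x $ i * X x $ j \<partial>M) - (\<integral>x. Y x $ i * Y x $ j \<partial>M)\<bar>
      = \<bar>\<integral>x. X x $ i * X x $ j - Y x $ i * Y x $ j \<partial>M\<bar>"
    using X Y by (subst Bochner_Integration.integral_diff) (auto intro!: ij)
  also have "\<dots> \<le> (\<integral>x. \<bar>X x $ i * X x $ j - Y x $ i * Y x $ j\<bar> \<partial>M)"
    by (rule integral_abs_bound)
  also have "\<dots> \<le> (\<integral>x. (norm (X x - Y x))\<^sup>2 + 2 * (norm (X x - Y x) * norm (Y x)) \<partial>M)"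
    using X Y D DY by (intro integral_mono pt integrable_abs Bochner_Integration.integrable_diff)
      (auto intro!: ij)
  also have "\<dots> = (\<integral>x. (norm (X x - Y x))\<^sup>2 \<partial>M) + 2 * (\<integral>x. norm (X x - Y x) * norm (Y x) \<partial>M)"
    using D DY by simp
  also have "\<dots> \<le> (\<integral>x. (norm (X x - Y x))\<^sup>2 \<partial>M)
       + 2 * (sqrt (\<integral>x. (norm (X x - Y x))\<^sup>2 \<partial>M) * sqrt (\<integral>x. (norm (Y x))\<^sup>2 \<partial>M))"
    by (intro add_left_mono mult_left_mono integral_norm_mult_le) (use D Y in measurable)
  finally show ?thesis .
qed

text \<open>Uncentred; for a law of mean zero it is the covariance matrix.\<close>

definition second_moment :: "(real^'d::finite) measure \<Rightarrow> real^'d^'d" where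
  "second_moment \<mu> = (\<chi> i j. \<integral>y. y $ i * y $ j \<partial>\<mu>)"

lemma P2_D:
  assumes "P2 \<mu>"
  shows "prob_space \<mu>" "sets \<mu> = sets borel" "space \<mu> = UNIV" "integrable \<mu> (\<lambda>x. (norm x)\<^sup>2)"
  using assms sets_eq_imp_space_eq[of \<mu> borel] by (auto simp: P2_def)

lemma P2_integrable_nth_mult:
  fixes \<mu> :: "(real^'d::finite) measure"
  assumes "P2 \<mu>"
  shows "integrable \<mu> (\<lambda>y. y $ i * y $ j)"
proof (rule Bochner_Integration.integrable_bound)
  note [measurable_cong] = P2_D(2)[OF assms]
  show "integrable \<mu> (\<lambda>x. (norm x)\<^sup>2)" by (rule P2_D(4)[OF assms])
  show "(\<lambda>y. y $ i * y $ j) \<in> borel_measurable \<mu>" by measurable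
  show "AE y in \<mu>. norm (y $ i * y $ j) \<le> norm ((norm y)\<^sup>2)"
    by (auto intro!: AE_I2 mult_mono component_le_norm_cart simp: abs_mult power2_eq_square)
qed

lemma P2_integrable_nth:
  fixes \<mu> :: "(real^'d::finite) measure"
  assumes "P2 \<mu>"
  shows "integrable \<mu> (\<lambda>y. y $ i)"
proof -
  interpret prob_space \<mu> by (rule P2_D(1)[OF assms])
  note [measurable_cong] = P2_D(2)[OF assms]
  show ?thesis
    by (rule square_integrable_imp_integrable)
      (use P2_integrable_nth_mult[OF assms, of i i] in \<open>measurable, simp add: power2_eq_square\<close>)
qed

lemma quadratic_form_eq_sum: "y \<bullet> (M *v y) = (\<Sum>i\<in>UNIV. \<Sum>j\<in>UNIV. M $ i $ j * (y $ i * y $ j))"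
  for M :: "real^'d::finite^'d"
  by (simp add: inner_vec_def matrix_vector_mult_def sum_distrib_left mult_ac)

text \<open>The inner product of \<open>real^'d^'d\<close> is the trace pairing, so expected
  quadratic forms become linear functionals of the second moment matrix. All variances below are
  handled in this form.\<close>

lemma
  fixes M :: "real^'d::finite^'d"
  assumes "P2 \<mu>"
  shows integrable_quadratic_form: "integrable \<mu> (\<lambda>y. y \<bullet> (M *v y))"
    and integral_quadratic_form: "(\<integral>y. y \<bullet> (M *v y) \<partial>\<mu>) = M \<bullet> second_moment \<mu>"
  unfolding quadratic_form_eq_sum
  using P2_integrable_nth_mult[OF assms] by (auto simp: second_moment_def inner_vec_def)

lemma integral_norm_sq: "P2 \<mu> \<Longrightarrow> (\<integral>y. (norm y)\<^sup>2 \<partial>\<mu>) = mat 1 \<bullet> second_moment \<mu>"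
  using integral_quadratic_form[of \<mu> "mat 1"] by (simp add: power2_norm_eq_inner)

lemma norm_matrix_vector_mult_sq: "(norm (M *v y))\<^sup>2 = y \<bullet> ((transpose M ** M) *v y)"
  for M :: "real^'n::finite^'k::finite"
  by (simp add: power2_norm_eq_inner matrix_vector_mul_assoc[symmetric] dot_lmul_matrix[symmetric]
      transpose_matrix_vector inner_commute[of y])

lemma P2_distr_matrix:
  fixes M :: "real^'n::finite^'k::finite"
  assumes "P2 \<mu>"
  shows "P2 (distr \<mu> borel ((*v) M))"
proof -
  interpret prob_space \<mu> by (rule P2_D(1)[OF assms])
  note [measurable_cong] = P2_D(2)[OF assms]
  have m: "(*v) M \<in> borel_measurable \<mu>" by measurable
  show ?thesis
    unfolding P2_def using prob_space_distr[OF m]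
    by (auto simp: integrable_distr_eq[OF m] norm_matrix_vector_mult_sq
        intro: integrable_quadratic_form[OF assms])
qed

lemma second_moment_distr_matrix:
  fixes M :: "real^'n::finite^'k::finite"
  assumes "P2 \<mu>"
  shows "second_moment (distr \<mu> borel ((*v) M)) = M ** second_moment \<mu> ** transpose M"
proof -
  note [measurable_cong] = P2_D(2)[OF assms]
  have "(\<integral>y. (M *v y) $ i * (M *v y) $ j \<partial>\<mu>) = (M ** second_moment \<mu> ** transpose M) $ i $ j" for i j
  proof -
    have e: "(M *v y) $ i * (M *v y) $ j = (\<Sum>k\<in>UNIV. \<Sum>l\<in>UNIV. M $ i $ l * M $ j $ k * (y $ l * y $ k))" for y
      by (simp add: matrix_vector_mult_def sum_product mult_ac) (subst sum.swap, simp add: mult_ac)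
    have "(\<integral>y. (M *v y) $ i * (M *v y) $ j \<partial>\<mu>)
        = (\<Sum>k\<in>UNIV. \<Sum>l\<in>UNIV. M $ i $ l * M $ j $ k * (\<integral>y. y $ l * y $ k \<partial>\<mu>))"
      unfolding e using P2_integrable_nth_mult[OF assms] by simp
    then show ?thesis
      by (simp add: matrix_matrix_mult_def transpose_def second_moment_def sum_distrib_left sum_distrib_right mult_ac)
  qed
  then show ?thesis
    by (simp add: second_moment_def vec_eq_iff integral_distr)
qed

lemma P2_I_nth_mult:
  fixes \<mu> :: "(real^'d::finite) measure"
  assumes "prob_space \<mu>" "sets \<mu> = sets borel" "\<And>i. integrable \<mu> (\<lambda>y. y $ i * y $ i)"
  shows "P2 \<mu>"
  using assms by (auto simp: P2_def power2_norm_eq_inner inner_vec_def)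

lemma
  assumes "s > 0"
  shows P2_gaussian: "P2 (gaussian s :: (real^'n::finite) measure)"
    and second_moment_gaussian: "second_moment (gaussian s :: (real^'n::finite) measure) = s\<^sup>2 *\<^sub>R mat 1"
  using assms
  by (auto intro!: P2_I_nth_mult prob_space_gaussian integrable_gaussian_nth_mult
      simp: second_moment_def vec_eq_iff integral_gaussian_nth_mult mat_def)

lemma mean_nth:
  fixes \<mu> :: "(real^'d::finite) measure"
  assumes "P2 \<mu>"
  shows "mean \<mu> $ i = (\<integral>y. y $ i \<partial>\<mu>)"
proof -
  interpret prob_space \<mu> by (rule P2_D(1)[OF assms])
  note [measurable_cong] = P2_D(2)[OF assms]
  have "norm \<in> borel_measurable \<mu>" by measurable
  then have "integrable \<mu> (\<lambda>y. norm y)"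
    using P2_D(4)[OF assms] by (rule square_integrable_imp_integrable)
  then have "integrable \<mu> (\<lambda>y. y)"
    by (subst (asm) integrable_norm_iff) measurable
  then show ?thesis
    unfolding mean_def
    by (rule integral_bounded_linear[OF bounded_linear_vec_nth, symmetric])
qed

lemma
  fixes L :: "real^'m::finite^'d::finite"
  shows P2_muL: "P2 (muL L)"
    and mean_muL: "mean (muL L) = 0"
    and second_moment_muL: "second_moment (muL L) = L ** transpose L"
    and Var_muL: "Var (muL L) = (\<integral>x. (norm x)\<^sup>2 \<partial>muL L)"
proof -
  have g: "P2 (std_gaussian :: (real^'m) measure)" by (rule P2_gaussian) simp
  show P: "P2 (muL L)"
    unfolding muL_def by (rule P2_distr_matrix[OF g])
  show "second_moment (muL L) = L ** transpose L"
    unfolding muL_def second_moment_distr_matrix[OF g] by (simp add: second_moment_gaussian)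
  have "mean (muL L) $ i = 0" for i
  proof -
    have "mean (muL L) $ i = (\<integral>w. (L *v w) $ i \<partial>std_gaussian)"
      unfolding mean_nth[OF P] by (simp add: muL_def integral_distr)
    also have "\<dots> = 0"
      by (simp add: matrix_vector_mult_def integrable_gaussian_nth integral_gaussian_nth)
    finally show ?thesis .
  qed
  then show m: "mean (muL L) = 0"
    by (simp add: vec_eq_iff)
  show "Var (muL L) = (\<integral>x. (norm x)\<^sup>2 \<partial>muL L)"
    by (simp add: Var_def m)
qed

lemma
  fixes f :: "'a \<Rightarrow> real" and g :: "'b \<Rightarrow> real"
  assumes "prob_space M" "prob_space N" and f: "integrable M f" and g: "integrable N g"
  shows integrable_pair_mult: "integrable (M \<Otimes>\<^sub>M N) (\<lambda>p. f (fst p) * g (snd p))"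
    and integral_pair_mult:
      "(\<integral>p. f (fst p) * g (snd p) \<partial>(M \<Otimes>\<^sub>M N)) = (\<integral>x. f x \<partial>M) * (\<integral>y. g y \<partial>N)"
proof -
  interpret M: prob_space M by fact
  interpret N: prob_space N by fact
  interpret pair_prob_space M N ..
  have [measurable]: "f \<in> borel_measurable M" "g \<in> borel_measurable N"
    using f g by auto
  show i: "integrable (M \<Otimes>\<^sub>M N) (\<lambda>p. f (fst p) * g (snd p))"
    by (rule Fubini_integrable) (use f g in \<open>auto simp: abs_mult\<close>)
  show "(\<integral>p. f (fst p) * g (snd p) \<partial>(M \<Otimes>\<^sub>M N)) = (\<integral>x. f x \<partial>M) * (\<integral>y. g y \<partial>N)"
    using integral_fst'[OF i] by simp
qed

text \<open>The signal and the noise are independent and the noise is centred, so the cross terms of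
  the expanded product integrate to zero.\<close>

lemma
  fixes M :: "real^'m::finite^'d::finite" and \<mu> :: "(real^'m) measure" and \<nu> :: "(real^'d) measure"
  assumes \<mu>: "P2 \<mu>" and \<nu>: "P2 \<nu>" and m0: "mean \<nu> = 0"
  shows P2_distr_sum: "P2 (distr (\<mu> \<Otimes>\<^sub>M \<nu>) borel (\<lambda>p. M *v fst p + snd p))"
    and second_moment_distr_sum: "second_moment (distr (\<mu> \<Otimes>\<^sub>M \<nu>) borel (\<lambda>p. M *v fst p + snd p))
      = M ** second_moment \<mu> ** transpose M + second_moment \<nu>"
proof -
  note p\<mu> = P2_D(1)[OF \<mu>] and p\<nu> = P2_D(1)[OF \<nu>]
  note [measurable_cong] = P2_D(2)[OF \<mu>] P2_D(2)[OF \<nu>]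
  interpret M: prob_space \<mu> by fact
  interpret N: prob_space \<nu> by fact
  interpret pp: pair_prob_space \<mu> \<nu> ..
  let ?\<mu> = "distr \<mu> borel ((*v) M)"
  have P: "P2 ?\<mu>" by (rule P2_distr_matrix[OF \<mu>])
  have Mi: "integrable \<mu> (\<lambda>x. (M *v x) $ i)" "integrable \<mu> (\<lambda>x. (M *v x) $ i * (M *v x) $ j)" for i j
    using P2_integrable_nth[OF P, of i] P2_integrable_nth_mult[OF P, of i j]
    by (simp_all add: integrable_distr_eq)
  have sm: "(\<integral>x. (M *v x) $ i * (M *v x) $ j \<partial>\<mu>) = (M ** second_moment \<mu> ** transpose M) $ i $ j" for i j
    using second_moment_distr_matrix[OF \<mu>, of M] by (simp add: second_moment_def vec_eq_iff integral_distr)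
  have N0: "(\<integral>y. y $ i \<partial>\<nu>) = 0" for i
    using mean_nth[OF \<nu>, of i] m0 by simp
  note i1 = P2_integrable_nth[OF \<nu>] and i2 = P2_integrable_nth_mult[OF \<nu>]
  note I = integrable_pair_mult[OF p\<mu> p\<nu>] and V = integral_pair_mult[OF p\<mu> p\<nu>]
  \<comment> \<open>The factors 1 bring every summand to the shape of a function of
    \<open>fst p\<close> times a function of \<open>snd p\<close>, as
    \<open>integral_pair_mult\<close> requires.\<close>
  have e: "(M *v fst p + snd p) $ i * (M *v fst p + snd p) $ j
      = (M *v fst p) $ i * (M *v fst p) $ j * 1 + (M *v fst p) $ i * snd p $ j + (M *v fst p) $ j * snd p $ i
        + 1 * (snd p $ i * snd p $ j)" for p :: "(real^'m) \<times> (real^'d)" and i j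
    by (simp add: algebra_simps)
  note J = I[OF Mi(2), of "\<lambda>_. 1"] I[OF Mi(1) i1] I[of "\<lambda>_. 1", OF _ i2]
  have int: "integrable (\<mu> \<Otimes>\<^sub>M \<nu>) (\<lambda>p. (M *v fst p + snd p) $ i * (M *v fst p + snd p) $ j)" for i j
    unfolding e by (intro Bochner_Integration.integrable_add J) auto
  have val: "(\<integral>p. (M *v fst p + snd p) $ i * (M *v fst p + snd p) $ j \<partial>(\<mu> \<Otimes>\<^sub>M \<nu>))
      = (M ** second_moment \<mu> ** transpose M + second_moment \<nu>) $ i $ j" for i j
    unfolding e
    apply (subst Bochner_Integration.integral_add, (intro Bochner_Integration.integrable_add J; simp)+)+
    apply (subst V[OF Mi(2), of "\<lambda>_. 1"], simp)
    apply (subst V[OF Mi(1) i1], subst V[OF Mi(1) i1])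
    apply (subst V[of "\<lambda>_. 1", OF _ i2], simp)
    apply (simp add: N0 sm M.prob_space N.prob_space second_moment_def)
    done
  have m: "(\<lambda>p. M *v fst p + snd p) \<in> borel_measurable (\<mu> \<Otimes>\<^sub>M \<nu>)" by measurable
  show "P2 (distr (\<mu> \<Otimes>\<^sub>M \<nu>) borel (\<lambda>p. M *v fst p + snd p))"
    using pp.P.prob_space_distr[OF m] int
    by (intro P2_I_nth_mult) (simp_all add: integrable_distr_eq[OF m])
  show "second_moment (distr (\<mu> \<Otimes>\<^sub>M \<nu>) borel (\<lambda>p. M *v fst p + snd p))
      = M ** second_moment \<mu> ** transpose M + second_moment \<nu>"
    using val by (simp add: second_moment_def[of "distr _ _ _"] vec_eq_iff integral_distr[OF m])
qed

subsection \<open>Couplings\<close>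

lemma
  assumes "\<pi> \<in> couplings \<mu> \<nu>"
  shows couplings_prob_space: "prob_space \<pi>"
    and couplings_fst_measurable: "fst \<in> borel_measurable \<pi>"
    and couplings_snd_measurable: "snd \<in> borel_measurable \<pi>"
proof -
  from assms have s[measurable_cong]: "sets \<pi> = sets (borel \<Otimes>\<^sub>M borel)" and "prob_space \<pi>"
    by (auto simp: couplings_def)
  show "prob_space \<pi>" "fst \<in> borel_measurable \<pi>" "snd \<in> borel_measurable \<pi>"
    by (fact, measurable)
qed

lemma
  fixes f :: "'a::euclidean_space \<Rightarrow> 'c::{banach, second_countable_topology}"
  assumes \<pi>: "\<pi> \<in> couplings \<mu> \<nu>" and f: "f \<in> borel_measurable borel"
  shows couplings_integral_fst: "(\<integral>p. f (fst p) \<partial>\<pi>) = (\<integral>x. f x \<partial>\<mu>)"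
    and couplings_integrable_fst: "integrable \<pi> (\<lambda>p. f (fst p)) \<longleftrightarrow> integrable \<mu> f"
proof -
  have \<mu>: "\<mu> = distr \<pi> borel fst"
    using \<pi> by (auto simp: couplings_def)
  show "(\<integral>p. f (fst p) \<partial>\<pi>) = (\<integral>x. f x \<partial>\<mu>)" "integrable \<pi> (\<lambda>p. f (fst p)) \<longleftrightarrow> integrable \<mu> f"
    unfolding \<mu> using couplings_fst_measurable[OF \<pi>] f by (simp_all add: integral_distr integrable_distr_eq)
qed

lemma
  fixes f :: "'b::euclidean_space \<Rightarrow> 'c::{banach, second_countable_topology}"
  assumes \<pi>: "\<pi> \<in> couplings \<mu> \<nu>" and f: "f \<in> borel_measurable borel"
  shows couplings_integral_snd: "(\<integral>p. f (snd p) \<partial>\<pi>) = (\<integral>x. f x \<partial>\<nu>)"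
    and couplings_integrable_snd: "integrable \<pi> (\<lambda>p. f (snd p)) \<longleftrightarrow> integrable \<nu> f"
proof -
  have \<nu>: "\<nu> = distr \<pi> borel snd"
    using \<pi> by (auto simp: couplings_def)
  show "(\<integral>p. f (snd p) \<partial>\<pi>) = (\<integral>x. f x \<partial>\<nu>)" "integrable \<pi> (\<lambda>p. f (snd p)) \<longleftrightarrow> integrable \<nu> f"
    unfolding \<nu> using couplings_snd_measurable[OF \<pi>] f by (simp_all add: integral_distr integrable_distr_eq)
qed

text \<open>The independent coupling; its cost is finite for laws with second moments, which makes
  the infimum in \<open>W2\<close> finite.\<close>

lemma pair_measure_in_couplings:
  assumes "P2 \<mu>" "P2 \<nu>"
  shows "\<mu> \<Otimes>\<^sub>M \<nu> \<in> couplings \<mu> \<nu>"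
proof -
  note [measurable_cong] = P2_D(2)[OF assms(1)] P2_D(2)[OF assms(2)]
  interpret M: prob_space \<mu> by (rule P2_D(1)[OF assms(1)])
  interpret N: prob_space \<nu> by (rule P2_D(1)[OF assms(2)])
  interpret pp: pair_prob_space \<mu> \<nu> ..
  have "distr (\<mu> \<Otimes>\<^sub>M \<nu>) borel fst = \<mu>"
    using N.distr_pair_fst[of \<mu>] P2_D(2)[OF assms(1)] by (simp cong: distr_cong)
  moreover have "distr (\<mu> \<Otimes>\<^sub>M \<nu>) borel snd = \<nu>"
  proof (rule measure_eqI)
    fix A assume "A \<in> sets (distr (\<mu> \<Otimes>\<^sub>M \<nu>) borel snd)"
    then have A: "A \<in> sets borel" by simp
    have "snd -` A \<inter> space (\<mu> \<Otimes>\<^sub>M \<nu>) = space \<mu> \<times> A"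
      using P2_D(3)[OF assms(2)] by (auto simp: space_pair_measure)
    with A show "emeasure (distr (\<mu> \<Otimes>\<^sub>M \<nu>) borel snd) A = emeasure \<nu> A"
      using P2_D(2)[OF assms(2)]
      by (subst emeasure_distr) (auto simp: N.emeasure_pair_measure_Times M.emeasure_space_1)
  qed (simp add: P2_D(2)[OF assms(2)])
  moreover have "sets (\<mu> \<Otimes>\<^sub>M \<nu>) = sets (borel \<Otimes>\<^sub>M borel)"
    by (intro sets_pair_measure_cong P2_D assms)
  ultimately show ?thesis
    using pp.P.prob_space_axioms by (simp add: couplings_def)
qed

lemma couplings_integrable_dist_sq:
  assumes \<mu>: "P2 \<mu>" and \<nu>: "P2 \<nu>" and \<pi>: "\<pi> \<in> couplings \<mu> \<nu>"
  shows "integrable \<pi> (\<lambda>p. (dist (fst p) (snd p))\<^sup>2)"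
proof -
  have "integrable \<pi> (\<lambda>p. (norm (fst p))\<^sup>2)" "integrable \<pi> (\<lambda>p. (norm (snd p))\<^sup>2)"
    using couplings_integrable_fst[OF \<pi>, of "\<lambda>x. (norm x)\<^sup>2"] P2_D(4)[OF \<mu>]
      couplings_integrable_snd[OF \<pi>, of "\<lambda>x. (norm x)\<^sup>2"] P2_D(4)[OF \<nu>] by auto
  then show ?thesis
    unfolding dist_norm
    by (intro integrable_inner_of_squares(3) couplings_fst_measurable[OF \<pi>] couplings_snd_measurable[OF \<pi>])
qed

text \<open>Couplings within \<open>e\<close> of the infimum replace optimal ones, so no compactness
  argument for their existence is needed.\<close>

lemma W2_approx_coupling:
  assumes \<mu>: "P2 \<mu>" and \<nu>: "P2 \<nu>" and e: "e > 0"
  shows "\<exists>\<pi>\<in>couplings \<mu> \<nu>. (\<integral>p. (dist (fst p) (snd p))\<^sup>2 \<partial>\<pi>) < (W2 \<mu> \<nu>)\<^sup>2 + e"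
proof -
  let ?c = "\<lambda>\<pi>. \<integral>\<^sup>+p. ennreal ((dist (fst p) (snd p))\<^sup>2) \<partial>\<pi>"
  let ?I = "INF \<pi>\<in>couplings \<mu> \<nu>. ?c \<pi>"
  have c: "?c \<pi> = ennreal (\<integral>p. (dist (fst p) (snd p))\<^sup>2 \<partial>\<pi>)" if "\<pi> \<in> couplings \<mu> \<nu>" for \<pi>
    using couplings_integrable_dist_sq[OF \<mu> \<nu> that] by (simp add: nn_integral_eq_integral)
  have "?I \<le> ?c (\<mu> \<Otimes>\<^sub>M \<nu>)"
    by (rule INF_lower) (rule pair_measure_in_couplings[OF \<mu> \<nu>])
  then have "?I < top"
    using c[OF pair_measure_in_couplings[OF \<mu> \<nu>]] by (simp add: le_less_trans)
  \<comment> \<open>\<open>enn2real\<close> sends \<open>top\<close> to 0, so finiteness has to be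
    known before it can be inverted.\<close>
  then have "?I = ennreal ((W2 \<mu> \<nu>)\<^sup>2)"
    by (simp add: W2_def)
  also have "\<dots> < ennreal ((W2 \<mu> \<nu>)\<^sup>2 + e)"
    using e by (intro ennreal_lessI) (simp_all add: add_nonneg_pos)
  finally obtain \<pi> where "\<pi> \<in> couplings \<mu> \<nu>" "?c \<pi> < ennreal ((W2 \<mu> \<nu>)\<^sup>2 + e)"
    by (auto simp: INF_less_iff)
  then show ?thesis
    using c by (intro bexI[of _ \<pi>]) (auto simp: ennreal_less_iff)
qed

subsection \<open>Kantorovich dominance for factor models\<close>

text \<open>\<open>P\<close> is the orthogonal projection onto the column space of \<open>U\<close>;
  its trace, and hence its squared norm in the trace inner product, is the rank. \<open>P\<close> is
  a separate variable so that the facts apply to named projections.\<close>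

lemma orth_cols_projection:
  fixes U :: "real^'m::finite^'d::finite"
  assumes U: "orth_cols U" and P: "P = U ** transpose U"
  shows "transpose P = P" "P ** P = P" "P ** U = U" "P \<bullet> P = CARD('m)" "mat 1 \<bullet> P = CARD('m)"
    "(norm (y - P *v y))\<^sup>2 = (norm y)\<^sup>2 - y \<bullet> (P *v y)"
    "norm (column k U) = 1"
proof -
  have UU: "transpose U ** U = mat 1" using U by (simp add: orth_cols_def)
  show s: "transpose P = P" by (simp add: P matrix_transpose_mul)
  show "P ** U = U" by (simp add: P matrix_mul_assoc[symmetric] UU)
  then show i: "P ** P = P" by (simp add: P matrix_mul_assoc)
  have tr: "A \<bullet> B = trace (transpose A ** B)" for A B :: "real^'d^'d"
    by (simp add: inner_vec_def trace_def matrix_matrix_mult_def transpose_def) (rule sum.swap)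
  have t: "trace P = CARD('m)"
    unfolding P by (subst trace_mul_sym) (simp add: UU trace_I)
  show "P \<bullet> P = CARD('m)" "mat 1 \<bullet> P = CARD('m)"
    by (simp_all add: tr s i t)
  have n: "(norm (P *v y))\<^sup>2 = y \<bullet> (P *v y)" for y
    by (simp add: norm_matrix_vector_mult_sq s i)
  have "(norm (y - P *v y))\<^sup>2 = (norm y)\<^sup>2 - 2 * (y \<bullet> (P *v y)) + (norm (P *v y))\<^sup>2"
    by (simp add: power2_norm_eq_inner inner_diff_left inner_diff_right inner_commute)
  then show "(norm (y - P *v y))\<^sup>2 = (norm y)\<^sup>2 - y \<bullet> (P *v y)"
    by (simp add: n)
  have "(transpose U ** U) $ k $ k = 1" by (simp add: UU mat_def)
  then show "norm (column k U) = 1"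
    by (simp add: norm_eq_1 inner_vec_def column_def matrix_matrix_mult_def transpose_def)
qed

lemma inner_matrix_mult_symmetric: "y \<bullet> (P *v x) = (P *v y) \<bullet> x"
  if "transpose P = P" for P :: "real^'d::finite^'d"
  using that dot_lmul_matrix[of y P x] transpose_matrix_vector[of P y] by simp

text \<open>For a coupled pair (X, Y) the dominance condition reads E(X . Y) = E|X|^2, and
  \<open>P\<close> fixes X almost surely, so \<open>\<delta>\<close> equals E|X - PY|^2. The second
  claim then compares the second moments of X and PY entry by entry.\<close>

lemma K_dom_muL:
  fixes L :: "real^'m::finite^'d::finite" and P :: "real^'d^'d"
  assumes \<nu>: "P20 \<nu>" and K: "K_dom (muL L) \<nu>"
    and s: "transpose P = P" and i: "P ** P = P" and PL: "P ** L = L"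
  defines "\<delta> \<equiv> P \<bullet> second_moment \<nu> - Var (muL L)"
  shows "0 \<le> \<delta>"
    and "\<bar>(L ** transpose L - P ** second_moment \<nu> ** P) $ a $ b\<bar>
      \<le> \<delta> + 2 * (sqrt \<delta> * sqrt (P \<bullet> second_moment \<nu>))"
proof -
  have P2: "P2 \<nu>" and m0: "mean \<nu> = 0" using \<nu> by (auto simp: P20_def)
  obtain \<pi> where \<pi>: "\<pi> \<in> couplings (muL L) \<nu>"
    and z: "(\<integral>p. fst p \<bullet> (snd p - fst p) \<partial>\<pi>) = 0"
    using K by (auto simp: K_dom_def m0)
  note [measurable] = couplings_fst_measurable[OF \<pi>] couplings_snd_measurable[OF \<pi>]
  have q: "(norm (P *v y))\<^sup>2 = y \<bullet> (P *v y)" for y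
    by (simp add: norm_matrix_vector_mult_sq s i)
  have X: "integrable \<pi> (\<lambda>p. (norm (fst p))\<^sup>2)"
    using couplings_integrable_fst[OF \<pi>, of "\<lambda>x. (norm x)\<^sup>2"] P2_D(4)[OF P2_muL[of L]] by simp
  have Y: "integrable \<pi> (\<lambda>p. (norm (snd p))\<^sup>2)"
    using couplings_integrable_snd[OF \<pi>, of "\<lambda>x. (norm x)\<^sup>2"] P2_D(4)[OF P2] by simp
  have PY: "integrable \<pi> (\<lambda>p. (norm (P *v snd p))\<^sup>2)"
    using couplings_integrable_snd[OF \<pi>, of "\<lambda>x. (norm (P *v x))\<^sup>2"] integrable_quadratic_form[OF P2, of P]
    by (simp add: q)
  have EX: "(\<integral>p. (norm (fst p))\<^sup>2 \<partial>\<pi>) = Var (muL L)"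
    using couplings_integral_fst[OF \<pi>, of "\<lambda>x. (norm x)\<^sup>2"] by (simp add: Var_muL)
  have EPY: "(\<integral>p. (norm (P *v snd p))\<^sup>2 \<partial>\<pi>) = P \<bullet> second_moment \<nu>"
    using couplings_integral_snd[OF \<pi>, of "\<lambda>x. (norm (P *v x))\<^sup>2"] integral_quadratic_form[OF P2, of P]
    by (simp add: q)
  have XY: "integrable \<pi> (\<lambda>p. fst p \<bullet> snd p)"
    by (intro integrable_inner_of_squares(1) X Y) measurable
  have XPY: "integrable \<pi> (\<lambda>p. fst p \<bullet> (P *v snd p))"
    by (intro integrable_inner_of_squares(1) X PY) measurable
  have EXY: "(\<integral>p. fst p \<bullet> snd p \<partial>\<pi>) = Var (muL L)"
  proof -
    have "(\<integral>p. fst p \<bullet> (snd p - fst p) \<partial>\<pi>) = (\<integral>p. fst p \<bullet> snd p \<partial>\<pi>) - (\<integral>p. (norm (fst p))\<^sup>2 \<partial>\<pi>)"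
      using XY X by (simp add: inner_diff_right power2_norm_eq_inner)
    then show ?thesis using z EX by simp
  qed
  \<comment> \<open>The law \<open>muL L\<close> lives on the range of \<open>L\<close>, where
    \<open>P\<close> is the identity; the first marginal carries this over to the coupling.\<close>
  have "AE x in muL L. P *v x = x"
    unfolding muL_def
    by (subst AE_distr_iff) (auto simp: matrix_vector_mul_assoc PL)
  moreover have "distr \<pi> borel fst = muL L"
    using \<pi> by (simp add: couplings_def)
  ultimately have "AE x in distr \<pi> borel fst. P *v x = x"
    by metis
  then have ae: "AE p in \<pi>. P *v fst p = fst p"
    by (subst (asm) AE_distr_iff) auto
  \<comment> \<open>By symmetry \<open>P\<close> moves onto the first factor, which it fixes almost
    everywhere.\<close>
  have EXPY: "(\<integral>p. fst p \<bullet> (P *v snd p) \<partial>\<pi>) = Var (muL L)"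
    unfolding EXY[symmetric]
    by (rule integral_cong_AE) (use ae in \<open>auto simp: inner_matrix_mult_symmetric[OF s]\<close>)
  have \<delta>: "(\<integral>p. (norm (fst p - P *v snd p))\<^sup>2 \<partial>\<pi>) = \<delta>"
  proof -
    have "(norm (fst p - P *v snd p))\<^sup>2
        = (norm (fst p))\<^sup>2 - 2 * (fst p \<bullet> (P *v snd p)) + (norm (P *v snd p))\<^sup>2" for p :: "(real^'d) \<times> (real^'d)"
      by (simp add: power2_norm_eq_inner inner_diff_left inner_diff_right inner_commute)
    then show ?thesis
      using X PY XPY by (simp add: EX EPY EXPY \<delta>_def)
  qed
  show "0 \<le> \<delta>"
    unfolding \<delta>[symmetric] by simp
  have "(\<integral>p. fst p $ a * fst p $ b \<partial>\<pi>) = (L ** transpose L) $ a $ b"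
    using couplings_integral_fst[OF \<pi>, of "\<lambda>x. x $ a * x $ b"] second_moment_muL[of L]
    by (simp add: second_moment_def vec_eq_iff)
  moreover have "(\<integral>p. (P *v snd p) $ a * (P *v snd p) $ b \<partial>\<pi>) = (P ** second_moment \<nu> ** P) $ a $ b"
    using couplings_integral_snd[OF \<pi>, of "\<lambda>x. (P *v x) $ a * (P *v x) $ b"]
      second_moment_distr_matrix[OF P2, of P] P2_D(2)[OF P2]
    by (simp add: s second_moment_def[of "distr _ _ _"] vec_eq_iff integral_distr)
  ultimately show "\<bar>(L ** transpose L - P ** second_moment \<nu> ** P) $ a $ b\<bar>
      \<le> \<delta> + 2 * (sqrt \<delta> * sqrt (P \<bullet> second_moment \<nu>))"
    using abs_integral_nth_mult_diff_le[of fst \<pi> "\<lambda>p. P *v snd p" a b, OF _ _ X PY]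
    by (simp add: \<delta> EPY)
qed

text \<open>The competitor is X = c PY, where Y has law \<open>\<nu>\<close> and is coupled by
  \<open>\<pi>\<close> with Y' of law \<open>\<nu>'\<close>. Then E(X . (Y' - X)) = c E(PY . Y') -
  c^2 E|PY|^2, and the hypothesis on \<open>c\<close> makes this vanish.\<close>

lemma scaled_projection_in_MK:
  fixes L :: "real^'m::finite^'d::finite" and P :: "real^'d^'d"
  assumes \<nu>': "P20 \<nu>'" and \<nu>: "P2 \<nu>" and \<pi>: "\<pi> \<in> couplings \<nu>' \<nu>"
    and s: "transpose P = P" and i: "P ** P = P"
    and law: "distr \<nu> borel ((*v) P) = muL L"
    and c: "c * (P \<bullet> second_moment \<nu>) = (\<integral>p. (P *v snd p) \<bullet> fst p \<partial>\<pi>)"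
  shows "muL (c *\<^sub>R L) \<in> MK \<nu>'" "Var (muL (c *\<^sub>R L)) = c\<^sup>2 * (P \<bullet> second_moment \<nu>)"
proof -
  have P2: "P2 \<nu>'" and m0: "mean \<nu>' = 0" using \<nu>' by (auto simp: P20_def)
  interpret \<pi>: prob_space \<pi> by (rule couplings_prob_space[OF \<pi>])
  note [measurable_cong] = P2_D(2)[OF \<nu>]
  note [measurable] = couplings_fst_measurable[OF \<pi>] couplings_snd_measurable[OF \<pi>]
  have \<pi>fst: "distr \<pi> borel fst = \<nu>'" and \<pi>snd: "distr \<pi> borel snd = \<nu>"
    using \<pi> by (auto simp: couplings_def)
  have law_c: "muL (c *\<^sub>R L) = distr \<nu> borel (\<lambda>y. c *\<^sub>R (P *v y))"
  proof -
    have "muL (c *\<^sub>R L) = distr (muL L) borel (\<lambda>x. c *\<^sub>R x)"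
      unfolding muL_def by (subst distr_distr) (simp_all add: comp_def scaleR_matrix_vector_assoc)
    also have "\<dots> = distr \<nu> borel (\<lambda>y. c *\<^sub>R (P *v y))"
      unfolding law[symmetric] by (subst distr_distr) (simp_all add: comp_def)
    finally show ?thesis .
  qed
  have q: "(norm (P *v y))\<^sup>2 = y \<bullet> (P *v y)" for y
    by (simp add: norm_matrix_vector_mult_sq s i)
  have Pq: "integrable \<nu> (\<lambda>y. (norm (P *v y))\<^sup>2)" "(\<integral>y. (norm (P *v y))\<^sup>2 \<partial>\<nu>) = P \<bullet> second_moment \<nu>"
    using integrable_quadratic_form[OF \<nu>, of P] integral_quadratic_form[OF \<nu>, of P] by (simp_all add: q)
  show "Var (muL (c *\<^sub>R L)) = c\<^sup>2 * (P \<bullet> second_moment \<nu>)"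
    unfolding Var_muL unfolding law_c
    by (subst integral_distr) (use Pq in \<open>simp_all add: power_mult_distrib\<close>)
  \<comment> \<open>The joint law of (c PY, Y'). The coordinates of \<open>\<pi>\<close> change
    places, since Y' is now the dominating variable.\<close>
  define \<rho> where "\<rho> = distr \<pi> (borel \<Otimes>\<^sub>M borel) (\<lambda>p. (c *\<^sub>R (P *v snd p), fst p))"
  have m[measurable]: "(\<lambda>p. (c *\<^sub>R (P *v snd p), fst p)) \<in> \<pi> \<rightarrow>\<^sub>M borel \<Otimes>\<^sub>M borel"
    by measurable
  have "distr \<rho> borel fst = distr (distr \<pi> borel snd) borel (\<lambda>y. c *\<^sub>R (P *v y))"
    unfolding \<rho>_def by (subst (1 2) distr_distr) (simp_all add: comp_def)
  moreover have "distr \<rho> borel snd = distr \<pi> borel fst"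
    unfolding \<rho>_def by (subst distr_distr) (simp_all add: comp_def)
  ultimately have \<rho>: "\<rho> \<in> couplings (muL (c *\<^sub>R L)) \<nu>'"
    using \<pi>.prob_space_distr[OF m]
    by (simp add: couplings_def \<pi>fst \<pi>snd law_c) (simp add: \<rho>_def)
  have Y: "integrable \<pi> (\<lambda>p. (norm (fst p))\<^sup>2)"
    using couplings_integrable_fst[OF \<pi>, of "\<lambda>x. (norm x)\<^sup>2"] P2_D(4)[OF P2] by simp
  have X: "integrable \<pi> (\<lambda>p. (norm (P *v snd p))\<^sup>2)" "(\<integral>p. (norm (P *v snd p))\<^sup>2 \<partial>\<pi>) = P \<bullet> second_moment \<nu>"
    using couplings_integrable_snd[OF \<pi>, of "\<lambda>x. (norm (P *v x))\<^sup>2"]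
      couplings_integral_snd[OF \<pi>, of "\<lambda>x. (norm (P *v x))\<^sup>2"] Pq by simp_all
  have XY: "integrable \<pi> (\<lambda>p. (P *v snd p) \<bullet> fst p)"
    by (intro integrable_inner_of_squares(1) X Y) measurable
  have e: "(c *\<^sub>R (P *v snd p)) \<bullet> (fst p - c *\<^sub>R (P *v snd p))
      = c * ((P *v snd p) \<bullet> fst p) - c\<^sup>2 * (norm (P *v snd p))\<^sup>2" for p :: "(real^'d) \<times> (real^'d)"
    by (simp add: inner_diff_right power2_norm_eq_inner power2_eq_square[of c])
  have "integrable \<rho> (\<lambda>p. fst p \<bullet> (snd p - fst p))"
    unfolding \<rho>_def
    by (subst integrable_distr_eq, measurable, unfold fst_conv snd_conv e) (use XY X in simp)
  moreover have "(\<integral>p. fst p \<bullet> (snd p - fst p) \<partial>\<rho>) = 0"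
    unfolding \<rho>_def
    by (subst integral_distr, measurable, unfold fst_conv snd_conv e)
      (use XY X c in \<open>simp add: power2_eq_square[of c]\<close>)
  ultimately have "K_dom (muL (c *\<^sub>R L)) \<nu>'"
    unfolding K_dom_def using \<rho> by (auto simp: m0)
  then show "muL (c *\<^sub>R L) \<in> MK \<nu>'"
    by (simp add: MK_def P2_muL)
qed

subsection \<open>The factor model and its limit\<close>

lemma inner_gram: "M \<bullet> (A ** transpose A) = (\<Sum>k\<in>UNIV. column k A \<bullet> (M *v column k A))"
  for M :: "real^'d::finite^'d" and A :: "real^'m::finite^'d"
proof -
  have "M \<bullet> (A ** transpose A) = (\<Sum>i\<in>UNIV. \<Sum>j\<in>UNIV. \<Sum>k\<in>UNIV. M $ i $ j * (A $ i $ k * A $ j $ k))"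
    by (simp add: inner_vec_def matrix_matrix_mult_def transpose_def sum_distrib_left)
  also have "\<dots> = (\<Sum>i\<in>UNIV. \<Sum>k\<in>UNIV. \<Sum>j\<in>UNIV. M $ i $ j * (A $ i $ k * A $ j $ k))"
    by (intro sum.cong refl sum.swap)
  also have "\<dots> = (\<Sum>k\<in>UNIV. \<Sum>i\<in>UNIV. \<Sum>j\<in>UNIV. M $ i $ j * (A $ i $ k * A $ j $ k))"
    by (rule sum.swap)
  finally show ?thesis
    by (simp add: quadratic_form_eq_sum column_def)
qed

lemma column_matrix_mult: "column k (A ** B) = A *v column k B"
  by (simp add: vec_eq_iff column_def matrix_matrix_mult_def matrix_vector_mult_def)

lemma column_mult_diag_sqrt: "column k (U ** diag_sqrt lam) = sqrt (lam $ k) *\<^sub>R column k U"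
  by (simp add: vec_eq_iff column_def matrix_matrix_mult_def diag_sqrt_def if_distrib[of "\<lambda>x. _ * x"] mult.commute
      cong: if_cong)

lemma inner_factor_gram:
  fixes M :: "real^'d::finite^'d" and U :: "real^'m::finite^'d"
  assumes "\<And>k. lam $ k \<ge> 0"
  shows "M \<bullet> ((U ** diag_sqrt lam) ** transpose (U ** diag_sqrt lam))
    = (\<Sum>k\<in>UNIV. lam $ k * (column k U \<bullet> (M *v column k U)))"
  using assms
  by (simp add: inner_gram column_mult_diag_sqrt matrix_vector_mult_scaleR mult.assoc[symmetric] real_sqrt_mult_self)

text \<open>The sign condition is there because the square root of \<open>c\<^sup>2\<close> is the
  absolute value of \<open>c\<close>. The identity keeps a rescaled factor in the form required by
  the Gaussian factor domain.\<close>

lemma diag_sqrt_scale: "c \<ge> 0 \<Longrightarrow> diag_sqrt (c\<^sup>2 *\<^sub>R lam) = c *\<^sub>R diag_sqrt lam"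
  by (simp add: diag_sqrt_def vec_eq_iff real_sqrt_mult)

lemma tendsto_matrix_mult:
  fixes A :: "'a \<Rightarrow> real^'n::finite^'m::finite" and B :: "'a \<Rightarrow> real^'k::finite^'n"
  assumes "(A \<longlongrightarrow> a) F" "(B \<longlongrightarrow> b) F"
  shows "((\<lambda>x. A x ** B x) \<longlongrightarrow> a ** b) F"
proof -
  have "((\<lambda>x. \<Sum>k\<in>UNIV. A x $ i $ k * B x $ k $ j) \<longlongrightarrow> (\<Sum>k\<in>UNIV. a $ i $ k * b $ k $ j)) F" for i j
    by (intro tendsto_intros tendsto_vec_nth assms)
  then show ?thesis
    by (intro vec_tendstoI) (simp add: matrix_matrix_mult_def)
qed

text \<open>Projections of equal rank m have squared norm m, so their squared distance is 2m minus
  twice their inner product. By \<open>inner_gram\<close> that inner product is the sum of the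
  quadratic forms assumed to tend to 1.\<close>

lemma tendsto_projection:
  fixes U :: "real^'m::finite^'d::finite" and V :: "nat \<Rightarrow> real^'m^'d"
  assumes U: "orth_cols U" and V: "\<And>n. orth_cols (V n)"
    and c: "\<And>k. (\<lambda>n. column k U \<bullet> ((V n ** transpose (V n)) *v column k U)) \<longlonglongrightarrow> 1"
  shows "(\<lambda>n. V n ** transpose (V n)) \<longlonglongrightarrow> U ** transpose U"
proof -
  let ?P = "\<lambda>n. V n ** transpose (V n)" and ?Q = "U ** transpose U"
  have "(norm (?P n - ?Q))\<^sup>2
      = 2 * real CARD('m) - 2 * (\<Sum>k\<in>UNIV. column k U \<bullet> (?P n *v column k U))" for n
    using orth_cols_projection(4)[OF U refl] orth_cols_projection(4)[OF V[of n] refl]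
    by (simp add: power2_norm_eq_inner inner_diff_left inner_diff_right inner_gram[of "?P n" U, symmetric] inner_commute)
  moreover have "(\<lambda>n. 2 * real CARD('m) - 2 * (\<Sum>k\<in>UNIV. column k U \<bullet> (?P n *v column k U)))
      \<longlonglongrightarrow> 2 * real CARD('m) - 2 * (\<Sum>k\<in>(UNIV::'m set). 1)"
    by (intro tendsto_intros c)
  ultimately have "(\<lambda>n. (norm (?P n - ?Q))\<^sup>2) \<longlonglongrightarrow> 0"
    by simp
  then have "(\<lambda>n. sqrt ((norm (?P n - ?Q))\<^sup>2)) \<longlonglongrightarrow> sqrt 0"
    by (rule tendsto_real_sqrt)
  then have "(\<lambda>n. norm (?P n - ?Q)) \<longlonglongrightarrow> 0"
    by simp
  then show ?thesis
    unfolding tendsto_norm_zero_iff by (rule LIM_zero_cancel)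
qed

text \<open>Only a vanishing cost of the couplings enters, not their optimality; the entrywise
  stability bound is applied to the two coordinates of each coupling.\<close>

lemma tendsto_second_moment:
  fixes \<nu> :: "(real^'d::finite) measure"
  assumes \<nu>n: "\<And>n. P2 (\<nu>n n)" and \<nu>: "P2 \<nu>" and \<pi>: "\<And>n. \<pi> n \<in> couplings (\<nu>n n) \<nu>"
    and d: "(\<lambda>n. \<integral>p. (dist (fst p) (snd p))\<^sup>2 \<partial>\<pi> n) \<longlonglongrightarrow> 0"
  shows "(\<lambda>n. second_moment (\<nu>n n)) \<longlonglongrightarrow> second_moment \<nu>"
proof (intro vec_tendstoI)
  fix i j
  let ?d = "\<lambda>n. \<integral>p. (dist (fst p) (snd p))\<^sup>2 \<partial>\<pi> n" and ?C = "\<integral>y. (norm y)\<^sup>2 \<partial>\<nu>"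
  have "\<bar>second_moment (\<nu>n n) $ i $ j - second_moment \<nu> $ i $ j\<bar> \<le> ?d n + 2 * (sqrt (?d n) * sqrt ?C)" for n
    using abs_integral_nth_mult_diff_le[of fst "\<pi> n" snd i j, OF couplings_fst_measurable[OF \<pi>] couplings_snd_measurable[OF \<pi>]]
      couplings_integral_fst[OF \<pi>[of n], of "\<lambda>x. x $ i * x $ j"]
      couplings_integral_snd[OF \<pi>[of n], of "\<lambda>x. x $ i * x $ j"]
      couplings_integral_snd[OF \<pi>[of n], of "\<lambda>x. (norm x)\<^sup>2"]
      couplings_integrable_fst[OF \<pi>[of n], of "\<lambda>x. (norm x)\<^sup>2"]
      couplings_integrable_snd[OF \<pi>[of n], of "\<lambda>x. (norm x)\<^sup>2"] P2_D(4)[OF \<nu>n[of n]] P2_D(4)[OF \<nu>]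
    by (simp add: second_moment_def dist_norm)
  moreover have "(\<lambda>n. ?d n + 2 * (sqrt (?d n) * sqrt ?C)) \<longlonglongrightarrow> 0 + 2 * (sqrt 0 * sqrt ?C)"
    by (intro tendsto_intros d)
  ultimately have "(\<lambda>n. second_moment (\<nu>n n) $ i $ j - second_moment \<nu> $ i $ j) \<longlonglongrightarrow> 0"
    by (rule_tac Lim_null_comparison[of _ "\<lambda>n. ?d n + 2 * (sqrt (?d n) * sqrt ?C)"]) simp_all
  then show "(\<lambda>n. second_moment (\<nu>n n) $ i $ j) \<longlonglongrightarrow> second_moment \<nu> $ i $ j"
    by (rule LIM_zero_cancel)
qed

text \<open>Split \<open>fst p\<close> as \<open>snd p\<close> plus the difference: the first part
  gives the limit exactly, and Cauchy-Schwarz bounds the second by the transport cost.\<close>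

lemma tendsto_coupling_correlation:
  fixes \<nu> :: "(real^'d::finite) measure"
  assumes \<nu>n: "\<And>n. P2 (\<nu>n n)" and \<nu>: "P2 \<nu>" and \<pi>: "\<And>n. \<pi> n \<in> couplings (\<nu>n n) \<nu>"
    and d: "(\<lambda>n. \<integral>p. (dist (fst p) (snd p))\<^sup>2 \<partial>\<pi> n) \<longlonglongrightarrow> 0"
  shows "(\<lambda>n. \<integral>p. (M *v snd p) \<bullet> fst p \<partial>\<pi> n) \<longlonglongrightarrow> M \<bullet> second_moment \<nu>"
proof -
  let ?d = "\<lambda>n. \<integral>p. (dist (fst p) (snd p))\<^sup>2 \<partial>\<pi> n" and ?C = "\<integral>y. (norm (M *v y))\<^sup>2 \<partial>\<nu>"
  have b: "\<bar>(\<integral>p. (M *v snd p) \<bullet> fst p \<partial>\<pi> n) - M \<bullet> second_moment \<nu>\<bar> \<le> sqrt ?C * sqrt (?d n)" for n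
  proof -
    note [measurable] = couplings_fst_measurable[OF \<pi>[of n]] couplings_snd_measurable[OF \<pi>[of n]]
    have X: "integrable (\<pi> n) (\<lambda>p. (norm (fst p - snd p))\<^sup>2)"
      using couplings_integrable_dist_sq[OF \<nu>n \<nu> \<pi>] by (simp add: dist_norm)
    have Y: "integrable (\<pi> n) (\<lambda>p. (norm (M *v snd p))\<^sup>2)" "(\<integral>p. (norm (M *v snd p))\<^sup>2 \<partial>\<pi> n) = ?C"
      using couplings_integrable_snd[OF \<pi>[of n], of "\<lambda>x. (norm (M *v x))\<^sup>2"]
        couplings_integral_snd[OF \<pi>[of n], of "\<lambda>x. (norm (M *v x))\<^sup>2"]
        integrable_quadratic_form[OF \<nu>, of "transpose M ** M"]
      by (simp_all add: norm_matrix_vector_mult_sq)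
    have Z: "integrable (\<pi> n) (\<lambda>p. (M *v snd p) \<bullet> snd p)" "(\<integral>p. (M *v snd p) \<bullet> snd p \<partial>\<pi> n) = M \<bullet> second_moment \<nu>"
      using couplings_integrable_snd[OF \<pi>[of n], of "\<lambda>x. (M *v x) \<bullet> x"]
        couplings_integral_snd[OF \<pi>[of n], of "\<lambda>x. (M *v x) \<bullet> x"]
        integrable_quadratic_form[OF \<nu>, of M] integral_quadratic_form[OF \<nu>, of M]
      by (simp_all add: inner_commute)
    have XY: "integrable (\<pi> n) (\<lambda>p. (M *v snd p) \<bullet> (fst p - snd p))"
      by (intro integrable_inner_of_squares(1) X Y) measurable
    have "(\<integral>p. (M *v snd p) \<bullet> fst p \<partial>\<pi> n)
        = (\<integral>p. (M *v snd p) \<bullet> (fst p - snd p) + (M *v snd p) \<bullet> snd p \<partial>\<pi> n)"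
      by (simp add: inner_diff_right)
    also have "\<dots> = (\<integral>p. (M *v snd p) \<bullet> (fst p - snd p) \<partial>\<pi> n) + M \<bullet> second_moment \<nu>"
      using XY Z by simp
    finally show ?thesis
      using abs_integral_inner_le[of "\<lambda>p. M *v snd p" "\<pi> n" "\<lambda>p. fst p - snd p", OF _ _ Y(1) X]
      by (simp add: Y(2) dist_norm)
  qed
  have "(\<lambda>n. sqrt ?C * sqrt (?d n)) \<longlonglongrightarrow> sqrt ?C * sqrt 0"
    by (intro tendsto_intros d)
  then have "(\<lambda>n. (\<integral>p. (M *v snd p) \<bullet> fst p \<partial>\<pi> n) - M \<bullet> second_moment \<nu>) \<longlonglongrightarrow> 0"
    by (rule_tac Lim_null_comparison[of _ "\<lambda>n. sqrt ?C * sqrt (?d n)"]) (use b in simp_all)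
  then show ?thesis
    by (rule LIM_zero_cancel)
qed

text \<open>The limit law projected onto the signal space is again a Gaussian factor law, with each
  eigenvalue raised by \<open>\<sigma>\<^sup>2\<close>. This makes it usable as a
  competitor.\<close>

lemma distr_projection_signal_plus_noise:
  fixes U :: "real^'m::finite^'d::finite"
  assumes U: "orth_cols U" and \<sigma>: "\<sigma> > 0" and lam: "\<And>k. lam $ k \<ge> 0"
  shows "distr (distr (std_gaussian \<Otimes>\<^sub>M gaussian \<sigma>) borel (\<lambda>p. (U ** diag_sqrt lam) *v fst p + snd p))
      borel ((*v) (U ** transpose U)) = muL (U ** diag_sqrt (\<chi> k. lam $ k + \<sigma>\<^sup>2))"
proof -
  let ?G = "std_gaussian \<Otimes>\<^sub>M gaussian \<sigma> :: ((real^'m) \<times> (real^'d)) measure"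
  have "distr (distr ?G borel (\<lambda>p. (U ** diag_sqrt lam) *v fst p + snd p)) borel ((*v) (U ** transpose U))
      = distr (distr ?G borel (\<lambda>p. transpose U *v ((U ** diag_sqrt lam) *v fst p + snd p))) borel ((*v) U)"
    by (subst (1 2) distr_distr)
      (simp_all add: comp_def matrix_vector_mul_assoc del: transpose_matrix_vector)
  also have "\<dots> = muL (U ** diag_sqrt (\<chi> k. lam $ k + \<sigma>\<^sup>2))"
    unfolding gaussian_signal_plus_noise[OF assms] muL_def
    by (subst distr_distr) (simp_all add: comp_def matrix_vector_mul_assoc)
  finally show ?thesis .
qed

text \<open>The witness is the point mass at 0, obtained from the zero spectrum. It is dominated by
  any centred law, as the case \<open>P = 0\<close>, \<open>c = 0\<close> of
  \<open>scaled_projection_in_MK\<close> shows; \<open>U\<close> only supplies a matrix with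
  orthonormal columns.\<close>

lemma GD_Int_MK_nonempty:
  fixes U :: "real^('m::{finite,linorder})^('d::finite)"
  assumes U: "orth_cols U" and \<nu>: "P20 \<nu>"
  shows "GD TYPE('m) \<inter> MK (\<nu> :: (real^'d) measure) \<noteq> {}"
proof -
  have P2: "P2 \<nu>" using \<nu> by (simp add: P20_def)
  have z: "(0 :: real^'k::finite^'l::finite) *v x = 0" for x
    by (simp add: matrix_vector_mult_def vec_eq_iff)
  have G: "prob_space (std_gaussian :: (real^('m::{finite,linorder})) measure)"
    by (rule prob_space_gaussian) simp
  have "distr \<nu> borel ((*v) (0 :: real^'d^'d)) = muL (0 :: real^('m::{finite,linorder})^'d)"
    unfolding muL_def z
    using prob_space.distr_const[OF P2_D(1)[OF P2], of "0 :: real^'d" borel]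
      prob_space.distr_const[OF G, of "0 :: real^'d" borel] by simp
  then have "muL (0 *\<^sub>R (0 :: real^('m::{finite,linorder})^'d)) \<in> MK \<nu>"
    by (intro scaled_projection_in_MK(1)[OF \<nu> P2 pair_measure_in_couplings[OF P2 P2], of 0])
      (simp_all add: z transpose_def matrix_matrix_mult_def vec_eq_iff)
  moreover have "diag_sqrt (0 :: real^('m::{finite,linorder})) = 0"
    by (simp add: vec_eq_iff diag_sqrt_def)
  then have "U ** diag_sqrt 0 = 0"
    by (simp add: vec_eq_iff matrix_matrix_mult_def)
  moreover have "admissible_spec (0 :: real^('m::{finite,linorder}))"
    by (simp add: admissible_spec_def)
  ultimately show ?thesis
    using U unfolding GD_def by (auto intro!: exI[of _ U] exI[of _ "0 :: real^('m::{finite,linorder})"])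
qed

theorem mainTheorem19:
  fixes Ustar :: "real^('m::{finite,linorder})^('d::finite)"
    and lamstar :: "real^('m::{finite,linorder})"
    and \<sigma> :: real
    and \<nu> :: "(real^'d) measure"
    and \<nu>n :: "nat \<Rightarrow> (real^'d) measure"
  assumes md: "card (UNIV :: 'm set) < card (UNIV :: 'd set)"
    and sig: "\<sigma> > 0"
    and U: "orth_cols Ustar"
    and lam_dec: "\<forall>i j. i \<le> j \<longrightarrow> lamstar $ j \<le> lamstar $ i"
    and lam_pos: "\<forall>i. lamstar $ i > 0"
    and nu: "\<nu> = distr ((std_gaussian :: (real^('m::{finite,linorder})) measure) \<Otimes>\<^sub>M (gaussian \<sigma> :: (real^'d) measure)) borel
                 (\<lambda>p. (Ustar ** diag_sqrt lamstar) *v fst p + snd p)"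
    and nun: "\<forall>n. P20 (\<nu>n n)"
    and conv: "(\<lambda>n. W2 (\<nu>n n) \<nu>) \<longlonglongrightarrow> 0"
  shows "(\<forall>n. (GD TYPE('m) :: (real^'d) measure set) \<inter> MK (\<nu>n n) \<noteq> {})
       \<and> (\<forall>Useq lamn.
           (\<forall>n. orth_cols (Useq n :: real^('m::{finite,linorder})^'d)
              \<and> admissible_spec (lamn n :: real^('m::{finite,linorder}))
              \<and> muL (Useq n ** diag_sqrt (lamn n)) \<in> MK (\<nu>n n)
              \<and> (\<forall>\<mu>\<in>(GD TYPE('m) :: (real^'d) measure set) \<inter> MK (\<nu>n n).
                    Var \<mu> \<le> Var (muL (Useq n ** diag_sqrt (lamn n)))))
           \<longrightarrow> (let Ln = (\<lambda>n. Useq n ** diag_sqrt (lamn n));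
                    s2 = (\<lambda>n. (1 / (real (card (UNIV :: 'd set)) - real (card (UNIV :: 'm set)))) *
                           (\<integral>y. (norm (y - (Useq n ** transpose (Useq n)) *v y))^2 \<partial>(\<nu>n n)))
                in ((\<lambda>n. Ln n ** transpose (Ln n) - s2 n *\<^sub>R (Useq n ** transpose (Useq n)))
                      \<longlonglongrightarrow> (Ustar ** diag_sqrt lamstar) ** transpose (Ustar ** diag_sqrt lamstar))
                   \<and> (s2 \<longlonglongrightarrow> \<sigma>^2)))"
proof (intro conjI allI impI)
  show "(GD TYPE('m) :: (real^'d) measure set) \<inter> MK (\<nu>n n) \<noteq> {}" for n
    using GD_Int_MK_nonempty[OF U] nun by simp
next
  fix V :: "nat \<Rightarrow> real^('m::{finite,linorder})^'d" and l :: "nat \<Rightarrow> real^('m::{finite,linorder})"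
  assume asm: "\<forall>n. orth_cols (V n) \<and> admissible_spec (l n)
      \<and> muL (V n ** diag_sqrt (l n)) \<in> MK (\<nu>n n)
      \<and> (\<forall>\<mu>\<in>GD TYPE('m) \<inter> MK (\<nu>n n). Var \<mu> \<le> Var (muL (V n ** diag_sqrt (l n))))"

  \<comment> \<open>Notation and second moments of the limit model\<close>
  define m d where "m = real CARD('m)" and "d = real CARD('d)"
  have m: "0 < m" "m < d" using md by (simp_all add: m_def d_def)
  define L where "L n = V n ** diag_sqrt (l n)" for n
  define P where "P n = V n ** transpose (V n)" for n
  define v where "v n = Var (muL (L n))" for n
  define S where "S n = second_moment (\<nu>n n)" for n
  define Ls where "Ls = Ustar ** diag_sqrt lamstar"
  define Q where "Q = Ustar ** transpose Ustar"
  define R where "R = second_moment \<nu>"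
  have V: "orth_cols (V n)" and LMK: "muL (L n) \<in> MK (\<nu>n n)"
    and opt: "\<And>\<mu>. \<mu> \<in> GD TYPE('m) \<Longrightarrow> \<mu> \<in> MK (\<nu>n n) \<Longrightarrow> Var \<mu> \<le> v n" for n
    using asm by (auto simp: L_def v_def)
  have lam0: "lamstar $ k \<ge> 0" for k using lam_pos by (simp add: less_imp_le)
  note Pp = orth_cols_projection[OF V P_def] and Qp = orth_cols_projection[OF U Q_def]
  have \<nu>nP2: "P2 (\<nu>n n)" for n using nun by (simp add: P20_def)
  have g1: "P2 (std_gaussian :: (real^('m::{finite,linorder})) measure)" by (rule P2_gaussian) simp
  have g2: "P2 (gaussian \<sigma> :: (real^'d) measure)" by (rule P2_gaussian) fact
  have g20: "mean (gaussian \<sigma> :: (real^'d) measure) = 0"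
    by (simp add: vec_eq_iff mean_nth[OF g2] integral_gaussian_nth[OF sig])
  have \<nu>P2: "P2 \<nu>"
    unfolding nu by (rule P2_distr_sum[OF g1 g2 g20])
  have R: "R = Ls ** transpose Ls + \<sigma>\<^sup>2 *\<^sub>R mat 1"
    unfolding R_def nu second_moment_distr_sum[OF g1 g2 g20]
    by (simp add: second_moment_gaussian[OF sig] second_moment_gaussian Ls_def)
  \<comment> \<open>Pairing with \<open>R\<close> splits into a signal part and a trace part; it is
    used for \<open>Q\<close>, for the identity and for the projections \<open>P n\<close>.\<close>
  have MR: "M \<bullet> R = (\<Sum>k\<in>UNIV. lamstar $ k * (column k Ustar \<bullet> (M *v column k Ustar))) + \<sigma>\<^sup>2 * (mat 1 \<bullet> M)" for M
    unfolding R by (simp add: inner_add_right Ls_def inner_factor_gram[OF lam0] inner_commute)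
  \<comment> \<open>\<open>s\<close> is the variance that \<open>Q\<close> captures under
    \<open>\<nu>\<close> (see \<open>QR\<close>); it turns out to bound
    \<open>P n \<bullet> R\<close> from above.\<close>
  define s where "s = (\<Sum>k\<in>UNIV. lamstar $ k) + \<sigma>\<^sup>2 * m"
  have s0: "s > 0"
    unfolding s_def using lam0 m sig by (simp add: sum_nonneg add_nonneg_pos)
  have QU: "Q *v column k Ustar = column k Ustar" for k
    using Qp(3) by (metis column_matrix_mult)
  have uu: "column k Ustar \<bullet> column k Ustar = 1" for k
    using Qp(7)[of k] by (simp add: norm_eq_1)
  have QR: "Q \<bullet> R = s"
    by (simp add: MR QU uu s_def Qp(5) m_def)
  have IR: "mat 1 \<bullet> R = (\<Sum>k\<in>UNIV. lamstar $ k) + \<sigma>\<^sup>2 * d"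
    by (simp add: MR uu d_def) (simp add: inner_vec_def mat_def if_distrib cong: if_cong)

  \<comment> \<open>Almost optimal couplings and convergence of second moments\<close>
  have "\<exists>\<pi>\<in>couplings (\<nu>n n) \<nu>. (\<integral>p. (dist (fst p) (snd p))\<^sup>2 \<partial>\<pi>) < (W2 (\<nu>n n) \<nu>)\<^sup>2 + 1 / real (Suc n)" for n
    by (rule W2_approx_coupling[OF \<nu>nP2 \<nu>P2]) simp
  then have "\<exists>\<pi>. \<forall>n. \<pi> n \<in> couplings (\<nu>n n) \<nu>
      \<and> (\<integral>p. (dist (fst p) (snd p))\<^sup>2 \<partial>\<pi> n) < (W2 (\<nu>n n) \<nu>)\<^sup>2 + 1 / real (Suc n)"
    by (intro choice) auto
  then obtain \<pi> where \<pi>: "\<And>n. \<pi> n \<in> couplings (\<nu>n n) \<nu>"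
    and \<pi>d: "\<And>n. (\<integral>p. (dist (fst p) (snd p))\<^sup>2 \<partial>\<pi> n) < (W2 (\<nu>n n) \<nu>)\<^sup>2 + 1 / real (Suc n)"
    by auto
  have "(\<lambda>n. (W2 (\<nu>n n) \<nu>)\<^sup>2 + 1 / real (Suc n)) \<longlonglongrightarrow> 0\<^sup>2 + 0"
    by (intro tendsto_intros conv LIMSEQ_Suc[OF lim_const_over_n])
  then have W0: "(\<lambda>n. (W2 (\<nu>n n) \<nu>)\<^sup>2 + 1 / real (Suc n)) \<longlonglongrightarrow> 0"
    by simp
  have d0: "(\<lambda>n. \<integral>p. (dist (fst p) (snd p))\<^sup>2 \<partial>\<pi> n) \<longlonglongrightarrow> 0"
  proof (rule tendsto_sandwich[OF _ _ tendsto_const W0])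
    show "\<forall>\<^sub>F n in sequentially. (\<integral>p. (dist (fst p) (snd p))\<^sup>2 \<partial>\<pi> n) \<le> (W2 (\<nu>n n) \<nu>)\<^sup>2 + 1 / real (Suc n)"
      by (intro always_eventually allI less_imp_le \<pi>d)
  qed simp
  have S: "S \<longlonglongrightarrow> R"
    unfolding S_def R_def by (rule tendsto_second_moment[OF \<nu>nP2 \<nu>P2 \<pi> d0])

  \<comment> \<open>Lower bound on the optimal variance from a rescaled competitor\<close>
  \<comment> \<open>Exactly the factor demanded by \<open>scaled_projection_in_MK\<close>, since
    \<open>Q \<bullet> R = s\<close>.\<close>
  define c where "c n = (\<integral>p. (Q *v snd p) \<bullet> fst p \<partial>\<pi> n) / s" for n
  have "c \<longlonglongrightarrow> s / s"
    unfolding c_def using tendsto_coupling_correlation[OF \<nu>nP2 \<nu>P2 \<pi> d0, of Q] s0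
    by (intro tendsto_intros) (simp_all add: QR[unfolded R_def])
  then have c: "c \<longlonglongrightarrow> 1" using s0 by simp
  define D where "D = (\<chi> k. lamstar $ k + \<sigma>\<^sup>2)"
  have law: "distr \<nu> borel ((*v) Q) = muL (Ustar ** diag_sqrt D)"
    unfolding nu Q_def D_def by (rule distr_projection_signal_plus_noise[OF U sig lam0])
  \<comment> \<open>The competitor has spectrum \<open>(c n)\<^sup>2 *\<^sub>R D\<close>, which
    inherits the ordering of \<open>lamstar\<close>. Nonnegativity of \<open>c n\<close> is needed
    for \<open>diag_sqrt_scale\<close> and holds eventually because \<open>c\<close> tends to
    1.\<close>
  have lower: "(c n)\<^sup>2 * s \<le> v n" if "c n \<ge> 0" for n
  proof -
    have cn: "c n * (Q \<bullet> second_moment \<nu>) = (\<integral>p. (Q *v snd p) \<bullet> fst p \<partial>\<pi> n)"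
      using s0 by (simp add: c_def QR[unfolded R_def])
    note MK = scaled_projection_in_MK[OF nun[rule_format] \<nu>P2 \<pi> Qp(1,2) law cn]
    have "c n *\<^sub>R (Ustar ** diag_sqrt D) = Ustar ** diag_sqrt ((c n)\<^sup>2 *\<^sub>R D)"
      using that by (simp add: diag_sqrt_scale matrix_scalar_ac scalar_matrix_assoc)
    moreover have "admissible_spec ((c n)\<^sup>2 *\<^sub>R D)"
      using lam_dec lam0 by (auto simp: admissible_spec_def D_def intro!: mult_left_mono)
    ultimately have "muL (c n *\<^sub>R (Ustar ** diag_sqrt D)) \<in> GD TYPE('m)"
      using U unfolding GD_def by auto
    from opt[OF this MK(1)] show ?thesis
      using MK(2) QR by (simp add: R_def)
  qed
  have PL: "P n ** L n = L n" for n
    using Pp(3)[of n] by (simp add: L_def matrix_mul_assoc)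
  have K: "K_dom (muL (L n)) (\<nu>n n)" for n
    using LMK by (simp add: MK_def)
  note KD = K_dom_muL[OF nun[rule_format] K Pp(1,2) PL, folded S_def v_def]
  have upper: "v n \<le> P n \<bullet> S n" for n
    using KD(1)[of n] by simp

  \<comment> \<open>Convergence of the projections\<close>
  \<comment> \<open>The norm of \<open>P n\<close> is the constant \<open>sqrt m\<close>, so
    \<open>S n\<close> may be replaced by \<open>R\<close> before \<open>P n\<close> is known to
    converge.\<close>
  have PS: "(\<lambda>n. P n \<bullet> (S n - R)) \<longlonglongrightarrow> 0"
  proof (rule Lim_null_comparison)
    have nP: "norm (P n) = sqrt m" for n
      using Pp(4)[of n] by (simp add: norm_eq_sqrt_inner m_def)
    have "norm (P n \<bullet> (S n - R)) \<le> sqrt m * norm (S n - R)" for n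
      using Cauchy_Schwarz_ineq2[of "P n" "S n - R"] by (simp add: nP)
    then show "\<forall>\<^sub>F n in sequentially. norm (P n \<bullet> (S n - R)) \<le> sqrt m * norm (S n - R)"
      by simp
    have "(\<lambda>n. sqrt m * norm (S n - R)) \<longlonglongrightarrow> sqrt m * norm (R - R)"
      by (intro tendsto_intros S)
    then show "(\<lambda>n. sqrt m * norm (S n - R)) \<longlonglongrightarrow> 0" by simp
  qed
  \<comment> \<open>\<open>t n k\<close> is the squared distance of the unit vector
    \<open>column k Ustar\<close> from the range of \<open>P n\<close>.\<close>
  define t where "t n k = 1 - column k Ustar \<bullet> (P n *v column k Ustar)" for n k
  have t0: "t n k \<ge> 0" for n k
    using Pp(6)[of "column k Ustar" n] zero_le_power2[of "norm (column k Ustar - P n *v column k Ustar)"]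
    by (simp add: t_def power2_norm_eq_inner[of "column k Ustar"] uu)
  \<comment> \<open>The noise is isotropic and \<open>P n\<close> has trace \<open>m\<close>, so the
    \<open>\<sigma>\<^sup>2\<close> terms cancel and only the lost signal remains.\<close>
  have gap: "s - P n \<bullet> R = (\<Sum>k\<in>UNIV. lamstar $ k * t n k)" for n
    by (simp add: MR t_def s_def Pp(5) m_def right_diff_distrib sum_subtractf)
  have gap0: "(\<lambda>n. s - P n \<bullet> R) \<longlonglongrightarrow> 0"
  proof (rule tendsto_sandwich[OF _ _ tendsto_const])
    show "\<forall>\<^sub>F n in sequentially. 0 \<le> s - P n \<bullet> R"
      unfolding gap using t0 lam0 by (simp add: sum_nonneg)
    have "\<forall>\<^sub>F n in sequentially. c n > 0"
      using c by (rule order_tendstoD) simp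
    then show "\<forall>\<^sub>F n in sequentially. s - P n \<bullet> R \<le> s - (c n)\<^sup>2 * s + P n \<bullet> (S n - R)"
    proof eventually_elim
      case (elim n)
      then show ?case
        using lower[of n] upper[of n] by (simp add: inner_diff_right)
    qed
    \<comment> \<open>The upper bound comes from chaining \<open>lower\<close> and
      \<open>upper\<close> and writing \<open>P n \<bullet> S n\<close> as
      \<open>P n \<bullet> R + P n \<bullet> (S n - R)\<close>.\<close>
    have "(\<lambda>n. s - (c n)\<^sup>2 * s + P n \<bullet> (S n - R)) \<longlonglongrightarrow> s - 1\<^sup>2 * s + 0"
      by (intro tendsto_intros c PS)
    then show "(\<lambda>n. s - (c n)\<^sup>2 * s + P n \<bullet> (S n - R)) \<longlonglongrightarrow> 0" by simp
  qed
  have P: "P \<longlonglongrightarrow> Q"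
    unfolding P_def Q_def
  proof (rule tendsto_projection[OF U V])
    fix k
    have "(\<lambda>n. t n k) \<longlonglongrightarrow> 0"
    proof (rule tendsto_sandwich[OF _ _ tendsto_const])
      show "\<forall>\<^sub>F n in sequentially. 0 \<le> t n k" by (simp add: t0)
      \<comment> \<open>All summands of the gap are nonnegative, so each is at most their sum;
        strict positivity of \<open>lamstar $ k\<close> then isolates \<open>t n k\<close>.\<close>
      have "lamstar $ k * t n k \<le> s - P n \<bullet> R" for n
        unfolding gap by (rule member_le_sum) (use t0 lam0 in auto)
      then show "\<forall>\<^sub>F n in sequentially. t n k \<le> (s - P n \<bullet> R) / lamstar $ k"
        using lam_pos by (simp add: pos_le_divide_eq mult.commute)
      show "(\<lambda>n. (s - P n \<bullet> R) / lamstar $ k) \<longlonglongrightarrow> 0"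
        using tendsto_divide[OF gap0 tendsto_const[of "lamstar $ k"]] lam_pos
        by (simp add: less_imp_neq[symmetric])
    qed
    then have "(\<lambda>n. 1 - t n k) \<longlonglongrightarrow> 1 - 0"
      by (intro tendsto_intros)
    then show "(\<lambda>n. column k Ustar \<bullet> ((V n ** transpose (V n)) *v column k Ustar)) \<longlonglongrightarrow> 1"
      by (simp add: t_def P_def)
  qed

  \<comment> \<open>Convergence of the optimal variances and Gram matrices\<close>
  have PSs: "(\<lambda>n. P n \<bullet> S n) \<longlonglongrightarrow> s"
    using tendsto_inner[OF P S] by (simp add: QR)
  have vs: "v \<longlonglongrightarrow> s"
  proof (rule tendsto_sandwich)
    show "\<forall>\<^sub>F n in sequentially. (c n)\<^sup>2 * s \<le> v n"
      using order_tendstoD(1)[OF c, of 0] by (auto elim!: eventually_mono intro!: lower)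
    show "\<forall>\<^sub>F n in sequentially. v n \<le> P n \<bullet> S n"
      by (simp add: upper)
    show "(\<lambda>n. (c n)\<^sup>2 * s) \<longlonglongrightarrow> s"
      using tendsto_mult[OF tendsto_power[OF c, of 2] tendsto_const[of s]] by simp
  qed (rule PSs)
  \<comment> \<open>The deficit \<open>P n \<bullet> S n - v n\<close> tends to 0 because both terms
    tend to \<open>s\<close>; the entrywise bound of \<open>K_dom_muL\<close> then vanishes in the
    limit.\<close>
  have LP: "(\<lambda>n. L n ** transpose (L n) - P n ** S n ** P n) \<longlonglongrightarrow> 0"
  proof (intro vec_tendstoI)
    fix i j
    have "(\<lambda>n. P n \<bullet> S n - v n) \<longlonglongrightarrow> s - s"
      by (intro tendsto_intros PSs vs)
    then have "(\<lambda>n. (P n \<bullet> S n - v n) + 2 * (sqrt (P n \<bullet> S n - v n) * sqrt (P n \<bullet> S n))) \<longlonglongrightarrow> 0 + 2 * (sqrt 0 * sqrt s)"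
      by (intro tendsto_intros PSs) simp_all
    then have r: "(\<lambda>n. (P n \<bullet> S n - v n) + 2 * (sqrt (P n \<bullet> S n - v n) * sqrt (P n \<bullet> S n))) \<longlonglongrightarrow> 0"
      by simp
    have "(\<lambda>n. (L n ** transpose (L n) - P n ** S n ** P n) $ i $ j) \<longlonglongrightarrow> 0"
      by (rule Lim_null_comparison[OF _ r], unfold real_norm_def)
        (intro always_eventually allI KD(2))
    then show "(\<lambda>n. (L n ** transpose (L n) - P n ** S n ** P n) $ i $ j) \<longlonglongrightarrow> (0 :: real^'d^'d) $ i $ j"
      by simp
  qed
  have "(\<lambda>n. (L n ** transpose (L n) - P n ** S n ** P n) + P n ** S n ** P n) \<longlonglongrightarrow> 0 + Q ** R ** Q"
    by (intro tendsto_add LP tendsto_matrix_mult P S)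
  then have LL: "(\<lambda>n. L n ** transpose (L n)) \<longlonglongrightarrow> Q ** R ** Q"
    by simp
  have QLs: "Q ** Ls = Ls" "transpose Ls ** Q = transpose Ls"
  proof -
    show a: "Q ** Ls = Ls"
      using Qp(3) by (simp add: Ls_def matrix_mul_assoc)
    show "transpose Ls ** Q = transpose Ls"
      using arg_cong[OF a, of transpose] by (simp add: matrix_transpose_mul Qp(1))
  qed
  \<comment> \<open>The limit carries a bias \<open>\<sigma>\<^sup>2 *\<^sub>R Q\<close> from noise
    inside the signal space; this is what the term with \<open>s2 n\<close> removes.\<close>
  have QRQ: "Q ** R ** Q = Ls ** transpose Ls + \<sigma>\<^sup>2 *\<^sub>R Q"
  proof -
    have rdistrib: "(A + B) ** Q = A ** Q + B ** Q" for A B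
      by (simp add: matrix_matrix_mult_def vec_eq_iff ring_distribs sum.distrib)
    have "Q ** (Ls ** transpose Ls) ** Q = (Q ** Ls) ** (transpose Ls ** Q)"
      by (simp add: matrix_mul_assoc)
    moreover have "Q ** (\<sigma>\<^sup>2 *\<^sub>R mat 1) ** Q = \<sigma>\<^sup>2 *\<^sub>R (Q ** Q)"
      by (simp add: matrix_scalar_ac scalar_matrix_assoc)
    ultimately show ?thesis
      unfolding R by (simp add: matrix_add_ldistrib rdistrib QLs Qp(2))
  qed

  \<comment> \<open>The residual variance estimator\<close>
  define s2 where "s2 n = (1 / (d - m)) * (\<integral>y. (norm (y - P n *v y))\<^sup>2 \<partial>\<nu>n n)" for n
  have s2_eq: "s2 n = (1 / (d - m)) * (mat 1 \<bullet> S n - P n \<bullet> S n)" for n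
    using P2_D(4)[OF \<nu>nP2[of n]] integrable_quadratic_form[OF \<nu>nP2[of n], of "P n"]
    by (simp add: s2_def Pp(6) integral_quadratic_form[OF \<nu>nP2] integral_norm_sq[OF \<nu>nP2] S_def)
  have "s2 \<longlonglongrightarrow> (1 / (d - m)) * (mat 1 \<bullet> R - s)"
    unfolding s2_eq[abs_def] by (intro tendsto_intros S PSs)
  \<comment> \<open>The trace of \<open>R\<close> exceeds \<open>s\<close> by the noise in the
    \<open>d - m\<close> directions orthogonal to the signal space, and \<open>m < d\<close> allows
    the division.\<close>
  moreover have "(1 / (d - m)) * (mat 1 \<bullet> R - s) = \<sigma>\<^sup>2"
    using m by (simp add: IR s_def field_simps)
  ultimately have s2: "s2 \<longlonglongrightarrow> \<sigma>\<^sup>2"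
    by simp
  have "(\<lambda>n. L n ** transpose (L n) - s2 n *\<^sub>R P n) \<longlonglongrightarrow> Q ** R ** Q - \<sigma>\<^sup>2 *\<^sub>R Q"
    by (intro tendsto_intros LL s2 P)
  with s2 show "let Ln = (\<lambda>n. V n ** diag_sqrt (l n));
          s2 = (\<lambda>n. (1 / (real (card (UNIV :: 'd set)) - real (card (UNIV :: 'm set)))) *
                 (\<integral>y. (norm (y - (V n ** transpose (V n)) *v y))^2 \<partial>(\<nu>n n)))
      in ((\<lambda>n. Ln n ** transpose (Ln n) - s2 n *\<^sub>R (V n ** transpose (V n)))
            \<longlonglongrightarrow> (Ustar ** diag_sqrt lamstar) ** transpose (Ustar ** diag_sqrt lamstar))
         \<and> (s2 \<longlonglongrightarrow> \<sigma>^2)"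
    unfolding Let_def by (simp add: QRQ s2_def[abs_def] P_def L_def Ls_def m_def d_def)
qed

end
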